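(* Let $s\in(0,1)$, and let $V_2=V_s$ be the $1$-periodic function on $\mathbb{R}$ with $$V_s(x)=-\frac{x}{s}\ \text{ for }x\in[0,s],\qquad V_s(x)=\frac{x-1}{1-s}\ \text{ for }x\in[s,1].$$ Let $m\ge2$, let $0=a_1<c_1<a_2<\cdots<a_{m-1}<c_{m-1}<a_m=1$, and let $V_1=\hat V$ be the $1$-periodic continuous function on $\mathbb{R}$ with $\hat V(a_i)=0$ for $1\le i\le m$, $\hat V(c_i)=-1$ for $1\le i\le m-1$, and $\hat V$ linear on each of the intervals $[a_i,c_i]$ and $[c_i,a_{i+1}]$, $1\le i\le m-1$. For a continuous coercive $H:\mathbb{R}\to\mathbb{R}$ let $\overline H_i$ be the effective Hamiltonian associated with $H(p)+V_i(x)$, $i=1,2$. Consider the condition $$(\ast)\qquad \sum_{i=1}^{m-1}\frac{c_i-a_i}{s}=\sum_{i=1}^{m-1}\frac{a_{i+1}-c_i}{1-s}.$$ (1) $V_1$ and $V_2$ are macroscopically indistinguishable if $(\ast)$ holds. (2) Let $F:[0,\infty)\to\mathbb{R}$ be a continuous function such that there exist $0<\theta_3<\theta_2<\theta_1$ with $F(0)=0$, $F(\theta_2)=\frac12$, $F(\theta_1)=F(\theta_3)=\frac13$, $\lim_{r\to+\infty}F(r)=+\infty$, $F$ strictly increasing on $[0,\theta_2]$ and on $[\theta_1,+\infty)$, and $F$ strictly decreasing on $[\theta_2,\theta_1]$. Then for $H(p)=F(|p|)$, $$\overline H_1\equiv\overline H_2\ \Longrightarrow\ (\ast)\text{ ho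lds}.$$
   Context: $\mathbb{T}=\mathbb{R}/\mathbb{Z}$; functions on $\mathbb{T}$ are identified with $1$-periodic functions on $\mathbb{R}$. A continuous $H:\mathbb{R}\to\mathbb{R}$ is coercive if $H(p)\to+\infty$ as $|p|\to\infty$. For such $H$ and $V\in C(\mathbb{T})$, the effective Hamiltonian $\overline H:\mathbb{R}\to\mathbb{R}$ associated with $H(p)+V(x)$ is defined as follows: for each $p\in\mathbb{R}$, $\overline H(p)$ is the unique constant $c\in\mathbb{R}$ such that the cell problem $H(p+v'(x))+V(x)=c$ in $\mathbb{T}$ has a continuous viscosity solution $v\in C(\mathbb{T})$. $V_1,V_2\in C(\mathbb{T})$ are macroscopically indistinguishable if, for every coercive continuous Hamiltonian $H:\mathbb{R}\to\mathbb{R}$, the effective Hamiltonians $\overline H_1,\overline H_2$ associated with $H(p)+V_1(x)$ and $H(p)+V_2(x)$ satisfy $\overline H_1\equiv\overline H_2$. *)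

theory Defs
  imports "HOL-Analysis.Analysis"
begin

text \<open>Functions on the torus \<open>\<real>/\<int>\<close> are represented by 1-periodic functions on the real line.\<close>

definition periodic1 :: "(real \<Rightarrow> real) \<Rightarrow> bool" where
  "periodic1 u \<longleftrightarrow> (\<forall>x. u (x + 1) = u x)"

definition C_torus :: "(real \<Rightarrow> real) set" where
  "C_torus = {u. continuous_on UNIV u \<and> periodic1 u}"

definition coercive :: "(real \<Rightarrow> real) \<Rightarrow> bool" where
  "coercive H \<longleftrightarrow> filterlim H at_top at_infinity"

text \<open>Viscosity sub- and supersolutions on the real line of \<open>G(x, u'(x)) = 0\<close>, with \<open>C\<^sup>1\<close> test
  functions touching from above and from below. Since the notion is local, for data and \<open>u\<close>
  1-periodic in \<open>x\<close> it is the same as being a sub- or supersolution on the torus.\<close>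

definition viscosity_subsolution :: "(real \<Rightarrow> real \<Rightarrow> real) \<Rightarrow> (real \<Rightarrow> real) \<Rightarrow> bool" where
  "viscosity_subsolution G u \<longleftrightarrow>
     (\<forall>\<phi> x0. \<phi> C1_differentiable_on UNIV \<longrightarrow>
        (\<forall>\<^sub>F x in nhds x0. u x - \<phi> x \<le> u x0 - \<phi> x0) \<longrightarrow> G x0 (deriv \<phi> x0) \<le> 0)"

definition viscosity_supersolution :: "(real \<Rightarrow> real \<Rightarrow> real) \<Rightarrow> (real \<Rightarrow> real) \<Rightarrow> bool" where
  "viscosity_supersolution G u \<longleftrightarrow>
     (\<forall>\<phi> x0. \<phi> C1_differentiable_on UNIV \<longrightarrow>
        (\<forall>\<^sub>F x in nhds x0. u x - \<phi> x \<ge> u x0 - \<phi> x0) \<longrightarrow> G x0 (deriv \<phi> x0) \<ge> 0)"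

definition viscosity_solution :: "(real \<Rightarrow> real \<Rightarrow> real) \<Rightarrow> (real \<Rightarrow> real) \<Rightarrow> bool" where
  "viscosity_solution G u \<longleftrightarrow> viscosity_subsolution G u \<and> viscosity_supersolution G u"

definition cell_problem_solution ::
    "(real \<Rightarrow> real) \<Rightarrow> (real \<Rightarrow> real) \<Rightarrow> real \<Rightarrow> real \<Rightarrow> (real \<Rightarrow> real) \<Rightarrow> bool" where
  "cell_problem_solution H V p c v \<longleftrightarrow>
     v \<in> C_torus \<and> viscosity_solution (\<lambda>x q. H (p + q) + V x - c) v"

text \<open>Meaningful for continuous coercive \<open>H\<close> and \<open>V \<in> C_torus\<close>, where the constant exists and is
  unique.\<close>

definition effective_hamiltonian :: "(real \<Rightarrow> real) \<Rightarrow> (real \<Rightarrow> real) \<Rightarrow> real \<Rightarrow> real" where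
  "effective_hamiltonian H V p = (THE c. \<exists>v. cell_problem_solution H V p c v)"

definition macroscopically_indistinguishable :: "(real \<Rightarrow> real) \<Rightarrow> (real \<Rightarrow> real) \<Rightarrow> bool" where
  "macroscopically_indistinguishable V1 V2 \<longleftrightarrow>
     V1 \<in> C_torus \<and> V2 \<in> C_torus \<and>
     (\<forall>H. continuous_on UNIV H \<and> coercive H \<longrightarrow>
        (\<forall>p. effective_hamiltonian H V1 p = effective_hamiltonian H V2 p))"

definition linear_on_interval :: "real \<Rightarrow> real \<Rightarrow> (real \<Rightarrow> real) \<Rightarrow> bool" where
  "linear_on_interval l r f \<longleftrightarrow> (\<exists>\<alpha> \<beta>. \<forall>x\<in>{l..r}. f x = \<alpha> * x + \<beta>)"

end

theory Submission imports Defs "HOL-Complex_Analysis.Great_Picard" begin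

text \<open>For every continuous coercive Hamiltonian the constant in the cell problem is unique (doubling of
  variables) and exists (Perron's method for the discounted equation, then vanishing discount), so
  effective Hamiltonians can be computed by exhibiting solutions. Let \<open>A = \<Sum>\<^sub>i (c\<^sub>i - a\<^sub>i)\<close>; condition
  \<open>(\<ast>)\<close> says \<open>A = s\<close>. Write \<open>u(x) = p x + v(x)\<close>. A solution \<open>u\<close> for the single tent \<open>V\<^sub>A\<close> becomes one for
  the sawtooth by gluing, on each monotone piece, a copy of \<open>u\<close> rescaled by the same factor in the
  domain and in the range: derivatives are unchanged, and the total increment of \<open>u\<close> is unchanged
  because the decreasing pieces have total length \<open>A\<close>. Hence the sawtooth and \<open>V\<^sub>A\<close> have the same
  effective Hamiltonian, which gives part (1).

  For part (2) it remains to separate \<open>V\<^sub>A\<close> from \<open>V\<^sub>s\<close>, say with \<open>A > s\<close>. Where the potential decreases,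
  \<open>u'\<close> has to jump from the lower increasing branch of \<open>F\<close> to the upper one at the level \<open>1/3\<close> of the
  local minimum; where it increases, \<open>u'\<close> has to jump back at the level \<open>1/2\<close> of the local maximum.
  This gives explicit solutions at levels \<open>c < 1/3\<close> whose slopes depend on \<open>A\<close>. A supersolution for
  \<open>V\<^sub>s\<close> at level \<open>1/3\<close> may jump back at any level \<open>t\<close> between \<open>1/3\<close> and \<open>1/2\<close>, which realises the same
  slope and contradicts comparison.\<close>

subsection \<open>Viscosity solutions and comparison\<close>

lemma C1_differentiable_on_UNIV_iff:
  "\<phi> C1_differentiable_on UNIV \<longleftrightarrow>
     (\<exists>\<phi>'. (\<forall>x. (\<phi> has_real_derivative \<phi>' x) (at x)) \<and> continuous_on UNIV \<phi>')"
  by (simp add: C1_differentiable_on_def has_real_derivative_iff_has_vector_derivative)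

text \<open>Test functions are carried together with an explicit continuous derivative, so that
  \<open>deriv\<close> does not occur in later arguments.\<close>

lemma viscosity_subsolutionI:
  assumes "\<And>\<phi> \<phi>' x0. (\<And>x. (\<phi> has_real_derivative \<phi>' x) (at x)) \<Longrightarrow> continuous_on UNIV \<phi>' \<Longrightarrow>
    \<forall>\<^sub>F x in nhds x0. u x - \<phi> x \<le> u x0 - \<phi> x0 \<Longrightarrow> G x0 (\<phi>' x0) \<le> 0"
  shows "viscosity_subsolution G u"
  unfolding viscosity_subsolution_def
proof (intro allI impI)
  fix \<phi> x0
  assume C1: "\<phi> C1_differentiable_on UNIV" and m: "\<forall>\<^sub>F x in nhds x0. u x - \<phi> x \<le> u x0 - \<phi> x0"
  from C1 obtain D where D: "\<And>x. (\<phi> has_real_derivative D x) (at x)" "continuous_on UNIV D"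
    unfolding C1_differentiable_on_UNIV_iff by auto
  have "G x0 (D x0) \<le> 0"
    using assms[OF D m] .
  then show "G x0 (deriv \<phi> x0) \<le> 0"
    using DERIV_imp_deriv[OF D(1)[of x0]] by simp
qed

lemma viscosity_subsolutionD:
  assumes "viscosity_subsolution G u" and "\<And>x. (\<phi> has_real_derivative \<phi>' x) (at x)"
    and "continuous_on UNIV \<phi>'" and "\<forall>\<^sub>F x in nhds z. u x - \<phi> x \<le> u z - \<phi> z"
  shows "G z (\<phi>' z) \<le> 0"
proof -
  have "\<phi> C1_differentiable_on UNIV"
    unfolding C1_differentiable_on_UNIV_iff using assms(2,3) by blast
  then have "G z (deriv \<phi> z) \<le> 0"
    using assms(1,4) unfolding viscosity_subsolution_def by blast
  then show ?thesis
    using DERIV_imp_deriv[OF assms(2)[of z]] by simp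
qed

lemma viscosity_supersolutionI:
  assumes "\<And>\<phi> \<phi>' x0. (\<And>x. (\<phi> has_real_derivative \<phi>' x) (at x)) \<Longrightarrow> continuous_on UNIV \<phi>' \<Longrightarrow>
    \<forall>\<^sub>F x in nhds x0. u x0 - \<phi> x0 \<le> u x - \<phi> x \<Longrightarrow> 0 \<le> G x0 (\<phi>' x0)"
  shows "viscosity_supersolution G u"
  unfolding viscosity_supersolution_def
proof (intro allI impI)
  fix \<phi> x0
  assume C1: "\<phi> C1_differentiable_on UNIV" and m: "\<forall>\<^sub>F x in nhds x0. u x - \<phi> x \<ge> u x0 - \<phi> x0"
  from C1 obtain D where D: "\<And>x. (\<phi> has_real_derivative D x) (at x)" "continuous_on UNIV D"
    unfolding C1_differentiable_on_UNIV_iff by auto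
  have "0 \<le> G x0 (D x0)"
    using assms[OF D m] .
  then show "G x0 (deriv \<phi> x0) \<ge> 0"
    using DERIV_imp_deriv[OF D(1)[of x0]] by simp
qed

text \<open>Negation turns a test function touching \<open>u\<close> from below into one touching
  \<open>- u\<close> from above. Most facts on supersolutions are obtained through this
  duality.\<close>

lemma viscosity_supersolution_iff_neg:
  "viscosity_supersolution G u \<longleftrightarrow> viscosity_subsolution (\<lambda>x q. - G x (- q)) (\<lambda>x. - u x)"
proof
  assume super: "viscosity_supersolution G u"
  show "viscosity_subsolution (\<lambda>x q. - G x (- q)) (\<lambda>x. - u x)"
  proof (rule viscosity_subsolutionI)
    fix \<phi> \<phi>' :: "real \<Rightarrow> real" and x0
    assume d: "\<And>x. (\<phi> has_real_derivative \<phi>' x) (at x)" and c: "continuous_on UNIV \<phi>'"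
      and m: "\<forall>\<^sub>F x in nhds x0. - u x - \<phi> x \<le> - u x0 - \<phi> x0"
    have d': "((\<lambda>x. - \<phi> x) has_real_derivative - \<phi>' x) (at x)" for x
      using d by (rule DERIV_minus)
    have "(\<lambda>x. - \<phi> x) C1_differentiable_on UNIV"
      unfolding C1_differentiable_on_UNIV_iff
      by (intro exI[of _ "\<lambda>x. - \<phi>' x"] conjI allI d' continuous_on_minus c)
    moreover have "\<forall>\<^sub>F x in nhds x0. u x - (- \<phi> x) \<ge> u x0 - (- \<phi> x0)"
      using m by eventually_elim simp
    ultimately have "G x0 (deriv (\<lambda>x. - \<phi> x) x0) \<ge> 0"
      using super unfolding viscosity_supersolution_def by blast
    then show "- G x0 (- \<phi>' x0) \<le> 0"
      using DERIV_imp_deriv[OF d'] by simp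
  qed
next
  assume sub: "viscosity_subsolution (\<lambda>x q. - G x (- q)) (\<lambda>x. - u x)"
  show "viscosity_supersolution G u"
    unfolding viscosity_supersolution_def
  proof (intro allI impI)
    fix \<phi> x0
    assume C1: "\<phi> C1_differentiable_on UNIV"
      and m: "\<forall>\<^sub>F x in nhds x0. u x - \<phi> x \<ge> u x0 - \<phi> x0"
    from C1 obtain D where D: "\<And>x. (\<phi> has_real_derivative D x) (at x)" "continuous_on UNIV D"
      unfolding C1_differentiable_on_UNIV_iff by auto
    have "- G x0 (- (- D x0)) \<le> 0"
    proof (rule viscosity_subsolutionD[OF sub, where \<phi> = "\<lambda>x. - \<phi> x" and \<phi>' = "\<lambda>x. - D x"])
      show "((\<lambda>x. - \<phi> x) has_real_derivative - D x) (at x)" for x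
        using D(1) by (rule DERIV_minus)
      show "continuous_on UNIV (\<lambda>x. - D x)"
        using D(2) by (rule continuous_on_minus)
      show "\<forall>\<^sub>F x in nhds x0. - u x - - \<phi> x \<le> - u x0 - - \<phi> x0"
        using m by eventually_elim simp
    qed
    then show "G x0 (deriv \<phi> x0) \<ge> 0"
      using DERIV_imp_deriv[OF D(1)] by simp
  qed
qed

text \<open>Adding \<open>p * x\<close> to the test function trades the shift of the slope for a
  linear term. The derivatives of \<open>p * x + v x\<close> are then the arguments of the
  Hamiltonian itself.\<close>

lemma viscosity_subsolution_add_linear:
  "viscosity_subsolution (\<lambda>x q. G x (p + q)) v \<longleftrightarrow> viscosity_subsolution G (\<lambda>x. p * x + v x)"
proof
  assume sub: "viscosity_subsolution (\<lambda>x q. G x (p + q)) v"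
  show "viscosity_subsolution G (\<lambda>x. p * x + v x)"
  proof (rule viscosity_subsolutionI)
    fix \<phi> \<phi>' :: "real \<Rightarrow> real" and x0
    assume d: "\<And>x. (\<phi> has_real_derivative \<phi>' x) (at x)" and c: "continuous_on UNIV \<phi>'"
      and m: "\<forall>\<^sub>F x in nhds x0. p * x + v x - \<phi> x \<le> p * x0 + v x0 - \<phi> x0"
    have "G x0 (p + (\<phi>' x0 - p)) \<le> 0"
      by (rule viscosity_subsolutionD[OF sub, where \<phi> = "\<lambda>x. \<phi> x - p * x" and \<phi>' = "\<lambda>x. \<phi>' x - p"])
        (use m in \<open>auto intro!: derivative_eq_intros d continuous_intros c simp: algebra_simps\<close>)
    then show "G x0 (\<phi>' x0) \<le> 0" by simp
  qed
next
  assume sub: "viscosity_subsolution G (\<lambda>x. p * x + v x)"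
  show "viscosity_subsolution (\<lambda>x q. G x (p + q)) v"
  proof (rule viscosity_subsolutionI)
    fix \<phi> \<phi>' :: "real \<Rightarrow> real" and x0
    assume d: "\<And>x. (\<phi> has_real_derivative \<phi>' x) (at x)" and c: "continuous_on UNIV \<phi>'"
      and m: "\<forall>\<^sub>F x in nhds x0. v x - \<phi> x \<le> v x0 - \<phi> x0"
    show "G x0 (p + \<phi>' x0) \<le> 0"
      by (rule viscosity_subsolutionD[OF sub, where \<phi> = "\<lambda>x. \<phi> x + p * x" and \<phi>' = "\<lambda>x. p + \<phi>' x"])
        (use m in \<open>auto intro!: derivative_eq_intros d continuous_intros c simp: algebra_simps\<close>)
  qed
qed

lemma viscosity_supersolution_add_linear:
  "viscosity_supersolution (\<lambda>x q. G x (p + q)) v \<longleftrightarrow> viscosity_supersolution G (\<lambda>x. p * x + v x)"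
  using viscosity_subsolution_add_linear[of "\<lambda>x q. - G x (- q)" "- p" "\<lambda>x. - v x"]
  by (simp add: viscosity_supersolution_iff_neg)

lemma periodic1_of_int:
  assumes "periodic1 u"
  shows "u (x + of_int k) = u x"
proof (induction k arbitrary: x rule: int_induct[where k = 0])
  case base
  then show ?case by simp
next
  case (step1 i)
  then show ?case
    using assms[unfolded periodic1_def, rule_format, of "x + of_int i"] by (simp add: add.assoc)
next
  case (step2 i)
  then show ?case
    using assms[unfolded periodic1_def, rule_format, of "x + of_int (i - 1)"] by (simp add: add.assoc)
qed

lemma periodic1_frac:
  assumes "periodic1 u"
  shows "u (frac x) = u x"
  using periodic1_of_int[OF assms, of x "- \<lfloor>x\<rfloor>"] by (simp add: frac_def)

lemma C_torus_bounded:
  assumes "u \<in> C_torus"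
  obtains B where "B > 0" "\<And>x. \<bar>u x\<bar> \<le> B"
proof -
  have "compact (u ` {0..1})"
    using assms by (intro compact_continuous_image)
      (auto simp: C_torus_def intro: continuous_on_subset)
  then obtain B where B: "B > 0" "\<And>y. y \<in> u ` {0..1} \<Longrightarrow> \<bar>y\<bar> \<le> B"
    using compact_imp_bounded bounded_pos by (metis real_norm_def)
  have "\<bar>u x\<bar> \<le> B" for x
  proof -
    have "u (frac x) \<in> u ` {0..1}"
      by (intro imageI) (auto simp: frac_ge_0 frac_lt_1 less_imp_le)
    then show ?thesis
      using B(2) periodic1_frac[of u x] assms by (simp add: C_torus_def)
  qed
  then show thesis using that B(1) by blast
qed

lemma C_torus_uniform:
  assumes "u \<in> C_torus" "e > 0"
  obtains d where "d > 0" "\<And>x y. \<bar>x - y\<bar> < d \<Longrightarrow> \<bar>u x - u y\<bar> < e"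
proof -
  \<comment> \<open>A common integer translation moves \<open>x\<close> into the unit interval; a
    point at distance below 1 from it still lies in \<open>{-1..2}\<close>.\<close>
  have "uniformly_continuous_on {-1..2} u"
    using assms(1) by (intro compact_uniformly_continuous)
      (auto simp: C_torus_def intro: continuous_on_subset)
  then obtain d where d: "d > 0"
    "\<And>x y. x \<in> {-1..2} \<Longrightarrow> y \<in> {-1..2} \<Longrightarrow> \<bar>y - x\<bar> < d \<Longrightarrow> \<bar>u y - u x\<bar> < e"
    using assms(2) unfolding uniformly_continuous_on_def dist_real_def by blast
  show thesis
  proof (rule that[of "min d 1"])
    show "min d 1 > 0" using d by simp
    fix x y :: real
    assume xy: "\<bar>x - y\<bar> < min d 1"
    define k where "k = - \<lfloor>x\<rfloor>"
    have "x + of_int k \<in> {0..1}"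
      unfolding k_def using of_int_floor_le[of x] real_of_int_floor_add_one_ge[of x] by (auto; linarith)
    then have "x + of_int k \<in> {-1..2}" "y + of_int k \<in> {-1..2}"
      using xy by (auto simp: abs_if split: if_splits)
    moreover have "\<bar>(x + of_int k) - (y + of_int k)\<bar> < d"
      using xy by simp
    ultimately have "\<bar>u (x + of_int k) - u (y + of_int k)\<bar> < e"
      using d(2) by blast
    then show "\<bar>u x - u y\<bar> < e"
      using assms(1) by (simp add: C_torus_def periodic1_of_int)
  qed
qed

text \<open>Doubling of variables: at a maximum of \<open>u x - v y - N * (x - y)^2\<close> both
  one-variable tests have the same slope \<open>q\<close>, so the terms \<open>H (p + q)\<close>
  cancel and \<open>c2 - c1 \<le> V y0 - V x0\<close> remains. A large \<open>N\<close> forces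
  \<open>x0\<close> and \<open>y0\<close> together, which makes the right-hand side too
  small.\<close>

lemma cell_comparison:
  assumes u: "u \<in> C_torus" and v: "v \<in> C_torus" and V: "V \<in> C_torus"
    and sub: "viscosity_subsolution (\<lambda>x q. H (p + q) + V x - c1) u"
    and super: "viscosity_supersolution (\<lambda>x q. H (p + q) + V x - c2) v"
  shows "c2 \<le> c1"
proof (rule ccontr)
  assume "\<not> c2 \<le> c1"
  then have "c2 - c1 > 0" by simp
  then obtain d where d: "d > 0" "\<And>x y. \<bar>x - y\<bar> < d \<Longrightarrow> \<bar>V x - V y\<bar> < c2 - c1"
    using C_torus_uniform[OF V] by blast
  obtain B1 where B1: "\<And>x. \<bar>u x\<bar> \<le> B1" using C_torus_bounded[OF u] by blast
  obtain B2 where B2: "B2 > 0" "\<And>x. \<bar>v x\<bar> \<le> B2" using C_torus_bounded[OF v] by blast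
  define B where "B = B1 + B2"
  have Bpos: "B > 0" unfolding B_def using B1[of 0] B2 by linarith
  \<comment> \<open>This gives \<open>N * d^2 > 2 * B\<close>. Comparing the maximum with the
    diagonal point \<open>(x0, x0)\<close> bounds its penalty by \<open>2 * B\<close>, hence
    \<open>\<bar>x0 - y0\<bar> < d\<close>.\<close>
  define N where "N = 2 * B / d^2 + 1"
  have Npos: "N > 0" and Nd: "N * d^2 > 2 * B"
    using Bpos d(1) by (simp_all add: N_def field_simps add_pos_pos)
  \<comment> \<open>Once \<open>x\<close> is translated into the unit interval,
    \<open>\<bar>y\<bar> > R\<close> makes the penalty exceed \<open>2 * B\<close> and pushes
    \<open>\<Phi>\<close> below \<open>\<Phi> (0, 0)\<close>. So a maximum over the compact
    rectangle is global.\<close>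
  define R where "R = 2 * B / N + 3"
  have RB: "N * (R - 1)^2 > 2 * B"
  proof -
    have R1: "R - 1 = 2 * B / N + 2" by (simp add: R_def)
    have "N * (R - 1) = 2 * B + 2 * N"
      unfolding R1 using Npos by (simp add: field_simps)
    moreover have "R - 1 \<ge> 1" unfolding R1 using Bpos Npos by simp
    then have "N * (R - 1)^2 \<ge> N * (R - 1) * 1"
      unfolding power2_eq_square mult.assoc[symmetric] using Npos
      by (intro mult_left_mono) auto
    ultimately show ?thesis using Npos by simp
  qed
  define \<Phi> where "\<Phi> z = u (fst z) - v (snd z) - N * (fst z - snd z)^2" for z :: "real \<times> real"
  have cu: "continuous_on UNIV u" and cv: "continuous_on UNIV v"
    using u v by (auto simp: C_torus_def)
  have "continuous_on ({0..1} \<times> {-R..R}) \<Phi>"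
    unfolding \<Phi>_def
    by (intro continuous_intros continuous_on_compose2[OF cu] continuous_on_compose2[OF cv]) auto
  moreover have "compact ({0..1::real} \<times> {-R..R})"
    by (intro compact_Times compact_Icc)
  moreover have "R > 0" unfolding R_def using Bpos Npos by (simp add: add_pos_pos)
  then have "{0..1::real} \<times> {-R..R} \<noteq> {}" by auto
  ultimately obtain z where z: "z \<in> {0..1} \<times> {-R..R}" "\<And>w. w \<in> {0..1} \<times> {-R..R} \<Longrightarrow> \<Phi> w \<le> \<Phi> z"
    using continuous_attains_sup by metis
  have Bb: "\<bar>u x - v y\<bar> \<le> B" for x y
    using B1[of x] B2(2)[of y] unfolding B_def by linarith
  have max: "\<Phi> (x, y) \<le> \<Phi> z" for x y
  proof -
    define k where "k = - \<lfloor>x\<rfloor>"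
    define x' y' where "x' = x + of_int k" and "y' = y + of_int k"
    have x': "x' \<in> {0..1}"
      unfolding k_def x'_def using of_int_floor_le[of x] real_of_int_floor_add_one_ge[of x] by (auto; linarith)
    have eq: "\<Phi> (x, y) = \<Phi> (x', y')"
      using u v by (simp add: \<Phi>_def x'_def y'_def C_torus_def periodic1_of_int)
    show ?thesis
    proof (cases "y' \<in> {-R..R}")
      case True
      then show ?thesis using x' eq z(2)[of "(x', y')"] by simp
    next
      case False
      then have "\<bar>x' - y'\<bar> \<ge> R - 1" using x' by auto
      then have "(x' - y')^2 \<ge> (R - 1)^2"
        using power2_abs[of "x' - y'"] \<open>R > 0\<close> power_mono[of "R - 1" "\<bar>x' - y'\<bar>" 2] Bpos Npos
        by (simp add: R_def)
      then have "N * (x' - y')^2 \<ge> N * (R - 1)^2" using Npos by simp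
      then have "\<Phi> (x', y') \<le> - B" using RB Bb[of x' y'] by (simp add: \<Phi>_def)
      also have "\<dots> \<le> \<Phi> (0, 0)" using Bb[of 0 0] by (simp add: \<Phi>_def abs_le_iff)
      also have "\<dots> \<le> \<Phi> z" using z(2)[of "(0, 0)"] \<open>R > 0\<close> by simp
      finally show ?thesis using eq by simp
    qed
  qed
  obtain x0 y0 where z_eq: "z = (x0, y0)" by (cases z)
  define q where "q = 2 * N * (x0 - y0)"
  have "N * (x0 - y0)^2 \<le> 2 * B"
    using max[of x0 x0] B2(2)[of x0] B2(2)[of y0] B1[of x0] unfolding z_eq \<Phi>_def B_def by simp
  then have "(x0 - y0)^2 < d^2"
    using Nd Npos by (smt (verit, best) mult_left_mono)
  then have close: "\<bar>x0 - y0\<bar> < d"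
    using d(1) by (metis less_eq_real_def power2_abs power2_less_imp_less)
  have "H (p + q) + V x0 - c1 \<le> 0"
    unfolding q_def
  proof (rule viscosity_subsolutionD[OF sub, where \<phi> = "\<lambda>x. N * (x - y0)^2" and \<phi>' = "\<lambda>x. 2 * N * (x - y0)"])
    show "((\<lambda>x. N * (x - y0)^2) has_real_derivative 2 * N * (x - y0)) (at x)" for x
      by (auto intro!: derivative_eq_intros)
    show "continuous_on UNIV (\<lambda>x. 2 * N * (x - y0))" by (intro continuous_intros)
    show "\<forall>\<^sub>F x in nhds x0. u x - N * (x - y0)^2 \<le> u x0 - N * (x0 - y0)^2"
      using max[of _ y0] by (intro always_eventually) (simp add: z_eq \<Phi>_def)
  qed
  moreover have "- (H (p + - (- q)) + V y0 - c2) \<le> 0"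
  proof -
    have "- (H (p + - (- (2 * N * (x0 - y0)))) + V y0 - c2) \<le> 0"
    proof (rule viscosity_subsolutionD[OF super[unfolded viscosity_supersolution_iff_neg],
          where \<phi> = "\<lambda>y. N * (x0 - y)^2" and \<phi>' = "\<lambda>y. - (2 * N * (x0 - y))"])
      show "((\<lambda>y. N * (x0 - y)^2) has_real_derivative - (2 * N * (x0 - y))) (at y)" for y
        by (auto intro!: derivative_eq_intros simp: algebra_simps)
      show "continuous_on UNIV (\<lambda>y. - (2 * N * (x0 - y)))" by (intro continuous_intros)
      show "\<forall>\<^sub>F y in nhds y0. - v y - N * (x0 - y)^2 \<le> - v y0 - N * (x0 - y0)^2"
        using max[of x0] by (intro always_eventually) (simp add: z_eq \<Phi>_def)
    qed
    then show ?thesis by (simp add: q_def)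
  qed
  ultimately have "c2 - c1 \<le> V y0 - V x0" by simp
  then show False using d(2)[OF close] by (simp add: abs_if split: if_splits)
qed

lemma derivative_eq_if_touching_above:
  fixes \<phi> \<psi> :: "real \<Rightarrow> real"
  assumes "(\<phi> has_real_derivative l) (at x)" "(\<psi> has_real_derivative k) (at x)"
    and "\<forall>\<^sub>F y in nhds x. \<phi> y - \<psi> y \<le> \<phi> x - \<psi> x"
  shows "k = l"
proof -
  obtain d where d: "d > 0" "\<And>y. \<bar>y - x\<bar> < d \<Longrightarrow> \<phi> y - \<psi> y \<le> \<phi> x - \<psi> x"
    using assms(3) unfolding eventually_nhds_metric dist_real_def by auto
  have "l - k = 0"
    by (rule DERIV_local_max[OF DERIV_diff[OF assms(1,2)] d(1)]) (use d(2) abs_minus_commute in metis)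
  then show ?thesis by simp
qed

subsection \<open>Rescaling of germs\<close>

text \<open>\<open>\<sigma>\<close> is 1 for the right-hand germ and -1 for the left-hand one. One
  factor scales both domain and range, so slopes are kept; it is quantified inside, so the two sides
  of a point may use different factors.\<close>

definition germ_similar :: "real \<Rightarrow> (real \<Rightarrow> real) \<Rightarrow> real \<Rightarrow> (real \<Rightarrow> real) \<Rightarrow> real \<Rightarrow> bool" where
  "germ_similar \<sigma> u x w y \<longleftrightarrow>
     (\<exists>\<rho>>0. \<forall>\<^sub>F h in at_right 0. u (x + \<sigma> * h) - u x = \<rho> * (w (y + \<sigma> * h / \<rho>) - w y))"

lemma germ_similarE:
  assumes "germ_similar \<sigma> u x w y"
  obtains \<rho> d where "\<rho> > 0" "d > 0"
    "\<And>h. 0 \<le> h \<Longrightarrow> h < d \<Longrightarrow> w (y + \<sigma> * h) - w y = (u (x + \<sigma> * (\<rho> * h)) - u x) / \<rho>"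
proof -
  from assms obtain \<rho> b where lb: "\<rho> > 0" "b > 0"
    "\<And>h. 0 < h \<Longrightarrow> h < b \<Longrightarrow> u (x + \<sigma> * h) - u x = \<rho> * (w (y + \<sigma> * h / \<rho>) - w y)"
    unfolding germ_similar_def eventually_at_right_field by auto
  show thesis
  proof (rule that[OF lb(1), of "b / \<rho>"])
    show "b / \<rho> > 0" using lb by simp
    fix h :: real
    assume h: "0 \<le> h" "h < b / \<rho>"
    show "w (y + \<sigma> * h) - w y = (u (x + \<sigma> * (\<rho> * h)) - u x) / \<rho>"
    proof (cases "h = 0")
      case False
      then have "0 < \<rho> * h" "\<rho> * h < b" using h lb by (auto simp: field_simps)
      then show ?thesis using lb(3)[of "\<rho> * h"] lb(1) by simp
    qed simp
  qed
qed

lemma germ_similar_uminus: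
  "germ_similar \<sigma> (\<lambda>x. - u x) x (\<lambda>x. - w x) y \<longleftrightarrow> germ_similar \<sigma> u x w y"
proof -
  have eq: "- a - - b = r * (- c - - d) \<longleftrightarrow> a - b = r * (c - d)" for a b c d r :: real
    by (auto simp: algebra_simps)
  show ?thesis unfolding germ_similar_def eq ..
qed

text \<open>One-sided superdifferentials are invariant under rescaling, and the two sides may be scaled
  differently: pulling a test function back piecewise keeps it \<open>C\<^sup>1\<close>.\<close>

lemma viscosity_subsolution_rescale:
  assumes sub: "viscosity_subsolution G w"
    and germ: "\<And>x. \<exists>y. (\<forall>q. G' x q = G y q) \<and> germ_similar 1 u x w y \<and> germ_similar (- 1) u x w y"
  shows "viscosity_subsolution G' u"
proof (rule viscosity_subsolutionI)
  fix \<phi> \<phi>' :: "real \<Rightarrow> real" and x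
  assume d: "\<And>x. (\<phi> has_real_derivative \<phi>' x) (at x)" and c: "continuous_on UNIV \<phi>'"
    and m: "\<forall>\<^sub>F z in nhds x. u z - \<phi> z \<le> u x - \<phi> x"
  obtain e where e: "e > 0" "\<And>z. \<bar>z - x\<bar> < e \<Longrightarrow> u z - \<phi> z \<le> u x - \<phi> x"
    using m unfolding eventually_nhds_metric dist_real_def by auto
  obtain y where y: "\<And>q. G' x q = G y q" "germ_similar 1 u x w y" "germ_similar (- 1) u x w y"
    using germ by blast
  obtain r d1 where r: "r > 0" "d1 > 0"
    "\<And>h. 0 \<le> h \<Longrightarrow> h < d1 \<Longrightarrow> w (y + h) - w y = (u (x + r * h) - u x) / r"
    using y(2) by (elim germ_similarE) auto
  obtain l d2 where l: "l > 0" "d2 > 0"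
    "\<And>h. 0 \<le> h \<Longrightarrow> h < d2 \<Longrightarrow> w (y - h) - w y = (u (x - l * h) - u x) / l"
    using y(3) by (elim germ_similarE) auto
  \<comment> \<open>At \<open>t = y\<close> both pieces have value 0 and slope
    \<open>\<phi>' x\<close>, whatever \<open>r\<close> and \<open>l\<close> are.\<close>
  define \<psi> where "\<psi> t = (if t \<in> {y..} then (\<phi> (x + r * (t - y)) - \<phi> x) / r
      else (\<phi> (x + l * (t - y)) - \<phi> x) / l)" for t
  define \<psi>' where "\<psi>' t = (if t \<in> {y..} then \<phi>' (x + r * (t - y)) else \<phi>' (x + l * (t - y)))" for t
  have piece: "((\<lambda>t. (\<phi> (x + k * (t - y)) - \<phi> x) / k) has_real_derivative \<phi>' (x + k * (t - y))) (at t)"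
    if "k > 0" for k t
    using that by (auto intro!: derivative_eq_intros DERIV_chain2[OF d])
  have "(\<psi> has_vector_derivative \<psi>' t) (at t within {y..} \<union> {..y})" for t
    unfolding \<psi>_def[abs_def] \<psi>'_def
    by (rule has_vector_derivative_If_within_closures)
      (use piece r(1) l(1) in \<open>auto simp: has_real_derivative_iff_has_vector_derivative[symmetric]
        intro: has_field_derivative_at_within\<close>)
  moreover have "{y..} \<union> {..y} = UNIV" by auto
  ultimately have d\<psi>: "(\<psi> has_real_derivative \<psi>' t) (at t)" for t
    by (simp add: has_real_derivative_iff_has_vector_derivative)
  have "continuous_on ({y..} \<union> {..y}) \<psi>'"
    unfolding \<psi>'_def[abs_def]
    by (rule continuous_on_cases) (auto intro!: continuous_intros continuous_on_compose2[OF c])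
  then have c\<psi>: "continuous_on UNIV \<psi>'" using \<open>{y..} \<union> {..y} = UNIV\<close> by simp
  define d' where "d' = min (min d1 d2) (min (e / r) (e / l))"
  have "d' > 0" using r l e unfolding d'_def by simp
  moreover have "w t - \<psi> t \<le> w y - \<psi> y" if t: "\<bar>t - y\<bar> < d'" for t
  proof (cases "t \<ge> y")
    case True
    define h where "h = t - y"
    have h: "0 \<le> h" "h < d1" "r * h < e"
      using True t r(1) by (auto simp: h_def d'_def field_simps)
    have "u (x + r * h) - \<phi> (x + r * h) \<le> u x - \<phi> x"
      using e(2)[of "x + r * h"] h r(1) by simp
    then have "(u (x + r * h) - u x) / r \<le> (\<phi> (x + r * h) - \<phi> x) / r"
      using r(1) by (intro divide_right_mono) auto
    then show ?thesis
      using r(3)[OF h(1,2)] True by (simp add: \<psi>_def h_def)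
  next
    case False
    define h where "h = y - t"
    have h: "0 \<le> h" "h < d2" "l * h < e"
      using False t l(1) by (auto simp: h_def d'_def field_simps)
    have eq: "x + l * (t - y) = x - l * h" by (simp add: h_def algebra_simps)
    have "u (x - l * h) - \<phi> (x - l * h) \<le> u x - \<phi> x"
      using e(2)[of "x - l * h"] h l(1) by simp
    then have "(u (x - l * h) - u x) / l \<le> (\<phi> (x - l * h) - \<phi> x) / l"
      using l(1) by (intro divide_right_mono) auto
    then show ?thesis
      using l(3)[OF h(1,2)] False eq by (simp add: \<psi>_def h_def)
  qed
  ultimately have "\<forall>\<^sub>F t in nhds y. w t - \<psi> t \<le> w y - \<psi> y"
    unfolding eventually_nhds_metric dist_real_def by blast
  then have "G y (\<psi>' y) \<le> 0"
    using viscosity_subsolutionD[OF sub d\<psi> c\<psi>] by blast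
  then show "G' x (\<phi>' x) \<le> 0"
    using y(1) by (simp add: \<psi>'_def)
qed

lemma viscosity_supersolution_rescale:
  assumes "viscosity_supersolution G w"
    and "\<And>x. \<exists>y. (\<forall>q. G' x q = G y q) \<and> germ_similar 1 u x w y \<and> germ_similar (- 1) u x w y"
  shows "viscosity_supersolution G' u"
  using assms unfolding viscosity_supersolution_iff_neg
  by (elim viscosity_subsolution_rescale) (metis germ_similar_uminus)

lemma germ_similar_shift: "germ_similar \<sigma> (\<lambda>x. u (x + a)) x u (x + a)"
  unfolding germ_similar_def by (intro exI[of _ 1]) (simp add: algebra_simps)

subsection \<open>Existence for the cell problem\<close>

text \<open>Adding \<open>(x - x0)\<^sup>2\<close> to the test function makes the maximum strict, hence stable under small
  perturbations of \<open>u\<close>.\<close>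

lemma perturbed_maximum:
  fixes u w \<phi> :: "real \<Rightarrow> real"
  assumes cont: "continuous_on UNIV w" "continuous_on UNIV \<phi>"
    and r: "r > 0" and \<epsilon>: "2 * \<epsilon> < r^2"
    and max: "\<And>x. \<bar>x - x0\<bar> \<le> r \<Longrightarrow> u x - \<phi> x \<le> u x0 - \<phi> x0"
    and up: "\<And>x. \<bar>x - x0\<bar> \<le> r \<Longrightarrow> w x \<le> u x + \<epsilon>" and low: "u x0 - \<epsilon> \<le> w x0"
  obtains y where "\<bar>y - x0\<bar> < r"
    "\<forall>\<^sub>F x in nhds y. w x - (\<phi> x + (x - x0)^2) \<le> w y - (\<phi> y + (y - x0)^2)"
    "w x0 - \<phi> x0 \<le> w y - (\<phi> y + (y - x0)^2)"
proof -
  define f where "f x = w x - (\<phi> x + (x - x0)^2)" for x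
  have "continuous_on {x0-r..x0+r} f"
    unfolding f_def by (intro continuous_intros continuous_on_subset[OF cont(1)] continuous_on_subset[OF cont(2)]) auto
  then obtain y where y: "y \<in> {x0-r..x0+r}" "\<And>x. x \<in> {x0-r..x0+r} \<Longrightarrow> f x \<le> f y"
    using continuous_attains_sup[of "{x0-r..x0+r}" f] r by auto
  have fx0: "f x0 \<le> f y" using y(2)[of x0] r by simp
  have "\<bar>y - x0\<bar> \<noteq> r"
  proof
    assume eq: "\<bar>y - x0\<bar> = r"
    then have "(y - x0)^2 = r^2" by (metis power2_abs)
    then have "f y \<le> u x0 - \<phi> x0 + \<epsilon> - r^2"
      using max[of y] up[of y] eq by (simp add: f_def)
    also have "\<dots> < f x0" using low \<epsilon> by (simp add: f_def)
    finally show False using fx0 by simp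
  qed
  then have yr: "\<bar>y - x0\<bar> < r" using y(1) by auto
  have "\<forall>\<^sub>F x in nhds y. f x \<le> f y"
    unfolding eventually_nhds_metric dist_real_def
  proof (intro exI[of _ "r - \<bar>y - x0\<bar>"] conjI allI impI)
    show "0 < r - \<bar>y - x0\<bar>" using yr by simp
    fix x assume "\<bar>x - y\<bar> < r - \<bar>y - x0\<bar>"
    then have "x \<in> {x0-r..x0+r}" by (auto simp: abs_if split: if_splits)
    then show "f x \<le> f y" by (rule y(2))
  qed
  then show thesis using that[OF yr] fx0 by (simp add: f_def)
qed

text \<open>If a secant slope exceeded \<open>L\<close>, subtracting the parabola
  \<open>L * (z - x) + K * (z - x)^2\<close> would leave an interior maximum to the right of
  \<open>x\<close>, and there the parabola touches from above with slope greater than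
  \<open>L\<close>.\<close>

lemma slope_le_if_touching_derivatives_le:
  fixes u :: "real \<Rightarrow> real"
  assumes cont: "continuous_on UNIV u" and bd: "\<And>x. \<bar>u x\<bar> \<le> B" and L: "L \<ge> 0"
    and test: "\<And>\<phi> \<phi>' x0. (\<And>x. (\<phi> has_real_derivative \<phi>' x) (at x)) \<Longrightarrow> continuous_on UNIV \<phi>' \<Longrightarrow>
      \<forall>\<^sub>F x in nhds x0. u x - \<phi> x \<le> u x0 - \<phi> x0 \<Longrightarrow> \<phi>' x0 \<le> L"
    and xy: "x < y"
  shows "u y - u x \<le> L * (y - x)"
proof (rule ccontr)
  assume "\<not> u y - u x \<le> L * (y - x)"
  define D where "D = u y - u x - L * (y - x)"
  have D: "D > 0" using \<open>\<not> _\<close> by (simp add: D_def)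
  \<comment> \<open>The quadratic term uses up only half of the excess \<open>D\<close> at
    \<open>y\<close>, so \<open>f y > f x\<close> survives.\<close>
  define K where "K = D / (2 * (y - x)^2)"
  have K: "K > 0" using D xy by (simp add: K_def)
  have Ky: "K * (y - x)^2 = D / 2" using xy by (simp add: K_def)
  have B: "B \<ge> 0" using bd[of 0] by simp
  \<comment> \<open>So far to the right the quadratic term is at least \<open>2 * B\<close> and
    outweighs any growth of the bounded \<open>u\<close>, hence
    \<open>f R \<le> f x\<close>.\<close>
  define R where "R = y + 2 * B / K + 1"
  have "2 * B / K \<ge> 0" using B K by simp
  then have R: "R - x \<ge> 1" "R - x \<ge> 2 * B / K" "R > y" using xy by (simp_all add: R_def)
  have "K * (R - x)^2 \<ge> 2 * B"
  proof -
    have "(R - x)^2 \<ge> 2 * B / K"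
      using mult_mono[OF R(2,1)] R(1) by (simp add: power2_eq_square)
    then show ?thesis using K by (simp add: field_simps)
  qed
  define \<phi> where "\<phi> z = L * (z - x) + K * (z - x)^2" for z
  define f where "f z = u z - \<phi> z" for z
  have "f y = u y - (L * (y - x) + D / 2)" "f x = u x" by (simp_all add: f_def \<phi>_def Ky)
  then have fy: "f y > f x" using D D_def by linarith
  have "L * (R - x) \<ge> 0" using L R by simp
  then have fR: "f R \<le> f x"
    using bd[of R] bd[of x] \<open>K * (R - x)^2 \<ge> 2 * B\<close> by (simp add: f_def \<phi>_def abs_le_iff)
  have "continuous_on {x..R} f"
    unfolding f_def \<phi>_def by (intro continuous_intros continuous_on_subset[OF cont]) auto
  then obtain z where z: "z \<in> {x..R}" "\<And>t. t \<in> {x..R} \<Longrightarrow> f t \<le> f z"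
    using continuous_attains_sup[of "{x..R}" f] R xy by auto
  have "f z \<ge> f y" using z(2)[of y] xy R by simp
  then have "z \<noteq> x" "z \<noteq> R" using fy fR by auto
  then have zin: "x < z" "z < R" using z(1) by auto
  have "L + 2 * K * (z - x) \<le> L"
  proof (rule test[of \<phi> "\<lambda>z. L + 2 * K * (z - x)"])
    show "(\<phi> has_real_derivative L + 2 * K * (t - x)) (at t)" for t
      unfolding \<phi>_def by (auto intro!: derivative_eq_intros)
    show "continuous_on UNIV (\<lambda>z. L + 2 * K * (z - x))" by (intro continuous_intros)
    have "\<forall>\<^sub>F t in nhds z. t \<in> {x<..<R}"
      using zin by (intro eventually_nhds_in_open) auto
    then show "\<forall>\<^sub>F t in nhds z. u t - \<phi> t \<le> u z - \<phi> z"
      by eventually_elim (use z(2) in \<open>auto simp: f_def\<close>)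
  qed
  then show False using K zin by (simp add: mult_le_0_iff)
qed

text \<open>Coercivity bounds the slope of every function touching from above. This controls
  increases directly; decreases are the increases of the reflected function \<open>u (- x)\<close>,
  which is again touched from above.\<close>

lemma coercive_subsolution_lipschitz:
  fixes u :: "real \<Rightarrow> real"
  assumes cont: "continuous_on UNIV u" and bd: "\<And>x. \<bar>u x\<bar> \<le> B" and L: "L \<ge> 0"
    and sub: "viscosity_subsolution G u" and coer: "\<And>x q. G x q \<le> 0 \<Longrightarrow> \<bar>q\<bar> \<le> L"
  shows "\<bar>u x - u y\<bar> \<le> L * \<bar>x - y\<bar>"
proof -
  have up: "u y - u x \<le> L * (y - x)" if "x < y" for x y
  proof (rule slope_le_if_touching_derivatives_le[OF cont bd L _ that])
    fix \<phi> \<phi>' :: "real \<Rightarrow> real" and x0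
    assume "\<And>x. (\<phi> has_real_derivative \<phi>' x) (at x)" "continuous_on UNIV \<phi>'"
      "\<forall>\<^sub>F x in nhds x0. u x - \<phi> x \<le> u x0 - \<phi> x0"
    from viscosity_subsolutionD[OF sub this] coer show "\<phi>' x0 \<le> L" by fastforce
  qed
  have down: "u x - u y \<le> L * (y - x)" if "x < y" for x y
  proof -
    have "u (- (- x)) - u (- (- y)) \<le> L * (- x - (- y))"
    proof (rule slope_le_if_touching_derivatives_le[where u = "\<lambda>z. u (- z)"])
      show "continuous_on UNIV (\<lambda>z. u (- z))"
        by (intro continuous_on_compose2[OF cont] continuous_intros) auto
      show "- y < - x" using that by simp
      fix \<phi> \<phi>' :: "real \<Rightarrow> real" and x0
      assume d: "\<And>x. (\<phi> has_real_derivative \<phi>' x) (at x)" and c: "continuous_on UNIV \<phi>'"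
        and m: "\<forall>\<^sub>F x in nhds x0. u (- x) - \<phi> x \<le> u (- x0) - \<phi> x0"
      have "G (- x0) (- \<phi>' (- (- x0))) \<le> 0"
      proof (rule viscosity_subsolutionD[OF sub, where \<phi> = "\<lambda>x. \<phi> (- x)" and \<phi>' = "\<lambda>x. - \<phi>' (- x)"])
        show "((\<lambda>x. \<phi> (- x)) has_real_derivative - \<phi>' (- x)) (at x)" for x
          using d[of "- x"] by (simp add: DERIV_mirror)
        show "continuous_on UNIV (\<lambda>x. - \<phi>' (- x))"
          by (intro continuous_intros continuous_on_compose2[OF c]) auto
        obtain e where e: "e > 0" "\<And>x. \<bar>x - x0\<bar> < e \<Longrightarrow> u (- x) - \<phi> x \<le> u (- x0) - \<phi> x0"
          using m unfolding eventually_nhds_metric dist_real_def by auto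
        have "u x - \<phi> (- x) \<le> u (- x0) - \<phi> (- (- x0))" if "\<bar>x - - x0\<bar> < e" for x
          using e(2)[of "- x"] that by (simp add: abs_minus_commute)
        then show "\<forall>\<^sub>F x in nhds (- x0). u x - \<phi> (- x) \<le> u (- x0) - \<phi> (- (- x0))"
          unfolding eventually_nhds_metric dist_real_def using e(1) by blast
      qed
      then show "\<phi>' x0 \<le> L" using coer by fastforce
    qed (use bd L in auto)
    then show ?thesis by simp
  qed
  show ?thesis
    using up[of x y] down[of x y] up[of y x] down[of y x]
    by (cases x y rule: linorder_cases) (auto simp: abs_if algebra_simps)
qed

section \<open>Perron's method for the discounted equation\<close>

text \<open>The solution is the supremum of all subsolutions between the constants
  \<open>- M\<close> and \<open>M\<close>. The level in the hypothesis on \<open>L\<close> comes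
  from \<open>\<delta> * w x \<ge> - (B + \<bar>H p\<bar>)\<close> and \<open>V x \<ge> - B\<close>,
  so it does not involve \<open>\<delta>\<close>.\<close>

lemma discounted_solution_exists:
  fixes H V :: "real \<Rightarrow> real"
  assumes H: "continuous_on UNIV H" and V: "V \<in> C_torus" and B: "\<And>x. \<bar>V x\<bar> \<le> B" "B \<ge> 0"
    and \<delta>: "\<delta> > 0" and L: "L \<ge> 0" "\<And>q. H (p + q) \<le> 2 * B + \<bar>H p\<bar> \<Longrightarrow> \<bar>q\<bar> \<le> L"
  obtains v where "periodic1 v" "\<And>x y. \<bar>v x - v y\<bar> \<le> L * \<bar>x - y\<bar>" "\<And>x. \<delta> * \<bar>v x\<bar> \<le> B + \<bar>H p\<bar>"
    "viscosity_subsolution (\<lambda>x q. \<delta> * v x + H (p + q) + V x) v"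
    "viscosity_supersolution (\<lambda>x q. \<delta> * v x + H (p + q) + V x) v"
proof -
  have contV: "continuous_on UNIV V" and perV: "periodic1 V" using V by (auto simp: C_torus_def)
  \<comment> \<open>With this \<open>M\<close> the constant \<open>- M\<close> is a subsolution and
    the constant \<open>M\<close> a supersolution.\<close>
  define M where "M = (B + \<bar>H p\<bar>) / \<delta>"
  have M: "M \<ge> 0" "\<delta> * M = B + \<bar>H p\<bar>" using \<delta> B by (auto simp: M_def)
  \<comment> \<open>The common Lipschitz bound passes to the supremum and makes it continuous.
    \<open>SI\<close> derives it from coercivity for each continuous competitor.\<close>
  define S where "S = {w. (\<forall>x. \<bar>w x\<bar> \<le> M) \<and> (\<forall>x y. \<bar>w x - w y\<bar> \<le> L * \<bar>x - y\<bar>) \<and>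
      viscosity_subsolution (\<lambda>x q. \<delta> * w x + H (p + q) + V x) w}"
  have SI: "w \<in> S" if "continuous_on UNIV w" "\<And>x. \<bar>w x\<bar> \<le> M"
    "viscosity_subsolution (\<lambda>x q. \<delta> * w x + H (p + q) + V x) w" for w
  proof -
    have "\<bar>w x - w y\<bar> \<le> L * \<bar>x - y\<bar>" for x y
    proof (rule coercive_subsolution_lipschitz[OF that(1,2) L(1) that(3)])
      fix x q assume "\<delta> * w x + H (p + q) + V x \<le> 0"
      moreover have "\<delta> * w x \<ge> \<delta> * (- M)" using that(2)[of x] \<delta> by (intro mult_left_mono) (auto simp: abs_le_iff)
      ultimately have "H (p + q) \<le> 2 * B + \<bar>H p\<bar>" using B(1)[of x] M(2) by (simp add: abs_le_iff)
      then show "\<bar>q\<bar> \<le> L" by (rule L(2))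
    qed
    then show ?thesis using that by (simp add: S_def)
  qed
  have bottom: "(\<lambda>x. - M) \<in> S"
  proof (rule SI)
    show "viscosity_subsolution (\<lambda>x q. \<delta> * - M + H (p + q) + V x) (\<lambda>x. - M)"
    proof (rule viscosity_subsolutionI)
      fix \<phi> \<phi>' :: "real \<Rightarrow> real" and x0
      assume d: "\<And>x. (\<phi> has_real_derivative \<phi>' x) (at x)"
        and m: "\<forall>\<^sub>F x in nhds x0. - M - \<phi> x \<le> - M - \<phi> x0"
      have "\<phi>' x0 = 0"
        by (rule derivative_eq_if_touching_above[OF DERIV_const d m])
      then show "\<delta> * - M + H (p + \<phi>' x0) + V x0 \<le> 0"
        using M(2) B(1)[of x0] abs_ge_self[of "H p"] by (simp add: abs_le_iff)
    qed
  qed (use M in auto)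
  define v where "v x = (SUP w\<in>S. w x)" for x
  have bdd: "bdd_above ((\<lambda>w. w x) ` S)" for x
    by (rule bdd_aboveI[of _ M]) (auto simp: S_def abs_le_iff)
  have ge: "w x \<le> v x" if "w \<in> S" for w x
    unfolding v_def by (rule cSUP_upper[OF that bdd])
  have le: "v x \<le> b" if "\<And>w. w \<in> S \<Longrightarrow> w x \<le> b" for x b
    unfolding v_def using bottom that by (intro cSUP_least) auto
  have lip: "\<bar>v x - v y\<bar> \<le> L * \<bar>x - y\<bar>" for x y
  proof -
    have half: "v x \<le> v y + L * \<bar>x - y\<bar>" for x y
    proof (rule le)
      fix w assume w: "w \<in> S"
      then have "\<bar>w x - w y\<bar> \<le> L * \<bar>x - y\<bar>" by (simp add: S_def)
      then show "w x \<le> v y + L * \<bar>x - y\<bar>" using ge[OF w, of y] by linarith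
    qed
    show ?thesis using half[of x y] half[of y x] by (auto simp: abs_minus_commute abs_le_iff)
  qed
  have cont: "continuous_on UNIV v"
    by (rule lipschitz_on_continuous_on[of L])
      (use lip L(1) in \<open>auto simp: lipschitz_on_def dist_real_def\<close>)
  have vM: "\<bar>v x\<bar> \<le> M" for x
    using ge[OF bottom, of x] le[of x M] by (auto simp: S_def abs_le_iff)
  \<comment> \<open>Competitors may be non-periodic, which permits a modification near a single
    point further down. Closure of \<open>S\<close> under integer translations is what makes the
    supremum periodic.\<close>
  have shift: "(\<lambda>x. w (x + of_int k)) \<in> S" if "w \<in> S" for w k
  proof -
    have "viscosity_subsolution (\<lambda>x q. \<delta> * w (x + of_int k) + H (p + q) + V x) (\<lambda>x. w (x + of_int k))"
    proof (rule viscosity_subsolution_rescale[of "\<lambda>x q. \<delta> * w x + H (p + q) + V x" w])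
      show "\<exists>y. (\<forall>q. \<delta> * w (x + of_int k) + H (p + q) + V x = \<delta> * w y + H (p + q) + V y) \<and>
          germ_similar 1 (\<lambda>x. w (x + of_int k)) x w y \<and> germ_similar (- 1) (\<lambda>x. w (x + of_int k)) x w y" for x
        by (intro exI[of _ "x + of_int k"] conjI germ_similar_shift) (simp add: periodic1_of_int[OF perV])
    qed (use that in \<open>simp add: S_def\<close>)
    moreover have "\<bar>w (x + of_int k) - w (y + of_int k)\<bar> \<le> L * \<bar>x - y\<bar>" for x y
      using that[unfolded S_def, simplified, THEN conjunct2, THEN conjunct1, rule_format, of "x + of_int k" "y + of_int k"]
      by simp
    ultimately show ?thesis using that by (simp add: S_def)
  qed
  have per: "periodic1 v"
    unfolding periodic1_def
  proof (intro allI antisym)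
    fix x
    show "v (x + 1) \<le> v x"
      by (rule le) (use ge[OF shift[of _ 1], of _ x] in simp)
    show "v x \<le> v (x + 1)"
      by (rule le) (use ge[OF shift[of _ "- 1"], of _ "x + 1"] in simp)
  qed
  have sub: "viscosity_subsolution (\<lambda>x q. \<delta> * v x + H (p + q) + V x) v"
  proof (rule viscosity_subsolutionI)
    fix \<phi> \<phi>' :: "real \<Rightarrow> real" and x0
    assume d: "\<And>x. (\<phi> has_real_derivative \<phi>' x) (at x)" and c: "continuous_on UNIV \<phi>'"
      and m: "\<forall>\<^sub>F x in nhds x0. v x - \<phi> x \<le> v x0 - \<phi> x0"
    have c\<phi>: "continuous_on UNIV \<phi>" using d DERIV_continuous_on by blast
    \<comment> \<open>The left-hand side of the equation along the perturbed test function
      \<open>\<phi> y + (y - x0)^2\<close>, with \<open>\<phi>\<close> lifted to the value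
      \<open>v x0\<close> at \<open>x0\<close>.\<close>
    define f where "f y = \<delta> * (v x0 + \<phi> y - \<phi> x0) + H (p + (\<phi>' y + 2 * (y - x0))) + V y" for y
    have cf: "continuous_on UNIV f"
      unfolding f_def
      by (intro continuous_intros continuous_on_compose2[OF H] c\<phi> c contV) auto
    show "\<delta> * v x0 + H (p + \<phi>' x0) + V x0 \<le> 0"
    proof (rule ccontr)
      assume "\<not> ?thesis"
      then have f0: "f x0 > 0" by (simp add: f_def)
      have "(f \<longlongrightarrow> f x0) (nhds x0)"
        using cf by (simp add: continuous_on_eq_continuous_at isCont_def tendsto_nhds_iff)
      then have "\<forall>\<^sub>F y in nhds x0. f y > f x0 / 2"
        using f0 by (intro order_tendstoD) auto
      with m have "\<forall>\<^sub>F y in nhds x0. f y > f x0 / 2 \<and> v y - \<phi> y \<le> v x0 - \<phi> x0"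
        by eventually_elim simp
      then obtain r where r: "r > 0"
        "\<And>y. \<bar>y - x0\<bar> \<le> r \<Longrightarrow> f y > f x0 / 2 \<and> v y - \<phi> y \<le> v x0 - \<phi> x0"
        unfolding eventually_nhds_metric_le dist_real_def by blast
      \<comment> \<open>The first bound keeps the maximum of a nearly optimal competitor away from
        the ends of the interval; the second limits the change of the discount term to half of
        \<open>f x0\<close>.\<close>
      define \<epsilon> where "\<epsilon> = min (r^2 / 4) (f x0 / (2 * \<delta>))"
      have \<epsilon>: "\<epsilon> > 0" "2 * \<epsilon> < r^2" "\<delta> * \<epsilon> \<le> f x0 / 2"
        using r(1) f0 \<delta> by (auto simp: \<epsilon>_def min_def field_simps)
      have "\<exists>w\<in>S. w x0 > v x0 - \<epsilon>"
        using le[of x0 "v x0 - \<epsilon>"] \<epsilon>(1) by (meson linorder_not_less diff_less_eq less_add_same_cancel1)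
      then obtain w where w: "w \<in> S" "w x0 > v x0 - \<epsilon>" by blast
      have wlip: "continuous_on UNIV w"
        by (rule lipschitz_on_continuous_on[of L])
          (use w(1) L(1) in \<open>auto simp: S_def lipschitz_on_def dist_real_def\<close>)
      obtain y where y: "\<bar>y - x0\<bar> < r"
        "\<forall>\<^sub>F x in nhds y. w x - (\<phi> x + (x - x0)^2) \<le> w y - (\<phi> y + (y - x0)^2)"
        "w x0 - \<phi> x0 \<le> w y - (\<phi> y + (y - x0)^2)"
      proof (rule perturbed_maximum[OF wlip c\<phi> r(1) \<epsilon>(2), of x0 v])
        show "w x \<le> v x + \<epsilon>" for x using ge[OF w(1), of x] \<epsilon>(1) by simp
      qed (use r(2) w(2) that in auto)
      have "\<delta> * w y + H (p + (\<phi>' y + 2 * (y - x0))) + V y \<le> 0"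
      proof (rule viscosity_subsolutionD[where u = w and z = y
            and G = "\<lambda>x q. \<delta> * w x + H (p + q) + V x" and \<phi> = "\<lambda>x. \<phi> x + (x - x0)^2"
            and \<phi>' = "\<lambda>y. \<phi>' y + 2 * (y - x0)"])
        show "viscosity_subsolution (\<lambda>x q. \<delta> * w x + H (p + q) + V x) w"
          using w(1) by (simp add: S_def)
        show "((\<lambda>x. \<phi> x + (x - x0)^2) has_real_derivative \<phi>' x + 2 * (x - x0)) (at x)" for x
          by (auto intro!: derivative_eq_intros d)
      qed (use y(2) in \<open>auto intro!: continuous_intros c\<close>)
      moreover have "w y \<ge> v x0 + \<phi> y - \<phi> x0 - \<epsilon>"
        using y(3) w(2) zero_le_power2[of "y - x0"] by linarith
      then have "\<delta> * w y \<ge> \<delta> * (v x0 + \<phi> y - \<phi> x0 - \<epsilon>)"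
        using \<delta> by simp
      then have "\<delta> * w y \<ge> \<delta> * (v x0 + \<phi> y - \<phi> x0) - f x0 / 2"
        using \<epsilon>(3) unfolding right_diff_distrib by linarith
      ultimately have "f y - f x0 / 2 \<le> 0" unfolding f_def[of y] by linarith
      then show False using r(2)[of y] y(1) by simp
    qed
  qed
  have super: "viscosity_supersolution (\<lambda>x q. \<delta> * v x + H (p + q) + V x) v"
  proof (rule viscosity_supersolutionI)
    fix \<phi> \<phi>' :: "real \<Rightarrow> real" and x0
    assume d: "\<And>x. (\<phi> has_real_derivative \<phi>' x) (at x)" and c: "continuous_on UNIV \<phi>'"
      and m: "\<forall>\<^sub>F x in nhds x0. v x0 - \<phi> x0 \<le> v x - \<phi> x"
    have c\<phi>: "continuous_on UNIV \<phi>" using d DERIV_continuous_on by blast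
    show "0 \<le> \<delta> * v x0 + H (p + \<phi>' x0) + V x0"
    \<comment> \<open>If \<open>v\<close> attains its upper bound at \<open>x0\<close>, a function
      touching from below has slope 0 there and the constant \<open>M\<close> does the job.
      Otherwise there is room to raise \<open>v\<close> near \<open>x0\<close>, against
      maximality.\<close>
    proof (cases "v x0 = M")
      case True
      have "\<forall>\<^sub>F x in nhds x0. \<phi> x - M \<le> \<phi> x0 - M"
        using m by eventually_elim (use vM True in \<open>auto simp: abs_le_iff\<close>, smt (verit) vM)
      then have "0 = \<phi>' x0"
        by (intro derivative_eq_if_touching_above[OF d DERIV_const])
      then show ?thesis using True M(2) B(1)[of x0] abs_ge_minus_self[of "H p"] by (simp add: abs_le_iff)
    next
      case False
      then have vlt: "v x0 < M" using vM[of x0] by (simp add: abs_le_iff)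
      show ?thesis
      proof (rule ccontr)
        assume neg: "\<not> ?thesis"
        \<comment> \<open>Subtracting the square gives
          \<open>v x \<ge> \<psi> x + (x - x0)^2\<close> near \<open>x0\<close>: the two functions
          meet at \<open>x0\<close> and are separated by at least \<open>r^2\<close> at distance
          \<open>r\<close>.\<close>
        define \<psi> where "\<psi> x = v x0 + \<phi> x - \<phi> x0 - (x - x0)^2" for x
        define f where "f x = \<delta> * \<psi> x + H (p + (\<phi>' x - 2 * (x - x0))) + V x" for x
        have f0: "f x0 < 0" using neg by (simp add: f_def \<psi>_def)
        have c\<psi>: "continuous_on UNIV \<psi>"
          unfolding \<psi>_def by (intro continuous_intros c\<phi>)
        have cf: "continuous_on UNIV f"
          unfolding f_def
          by (intro continuous_intros continuous_on_compose2[OF H] c\<psi> c contV) auto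
        have tends: "(f \<longlongrightarrow> f x0) (nhds x0)" "(\<psi> \<longlongrightarrow> \<psi> x0) (nhds x0)"
          using cf c\<psi> by (simp_all add: continuous_on_eq_continuous_at isCont_def tendsto_nhds_iff)
        have "\<forall>\<^sub>F x in nhds x0. f x < f x0 / 2"
          by (rule order_tendstoD(2)[OF tends(1)]) (use f0 in simp)
        moreover have "\<forall>\<^sub>F x in nhds x0. \<psi> x < (v x0 + M) / 2"
          by (rule order_tendstoD(2)[OF tends(2)]) (use vlt in \<open>simp add: \<psi>_def\<close>)
        ultimately have "\<forall>\<^sub>F x in nhds x0. f x < f x0 / 2 \<and> \<psi> x < (v x0 + M) / 2 \<and> v x0 - \<phi> x0 \<le> v x - \<phi> x"
          using m by eventually_elim simp
        then obtain r where r: "r > 0"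
          "\<And>x. \<bar>x - x0\<bar> \<le> r \<Longrightarrow> f x < f x0 / 2 \<and> \<psi> x < (v x0 + M) / 2 \<and> v x0 - \<phi> x0 \<le> v x - \<phi> x"
          unfolding eventually_nhds_metric_le dist_real_def by blast
        \<comment> \<open>The three bounds serve in turn: the raised bump falls below
          \<open>v\<close> at the edge, so \<open>w\<close> is continuous; the bump is still a
          subsolution; it stays below \<open>M\<close>.\<close>
        define \<epsilon> where "\<epsilon> = min (r^2 / 2) (min (- f x0 / (2 * \<delta>)) ((M - v x0) / 2))"
        have "\<epsilon> \<le> r^2 / 2" "\<epsilon> \<le> - f x0 / (2 * \<delta>)" by (simp_all add: \<epsilon>_def)
        moreover have "r^2 > 0" using r(1) by simp
        moreover have "\<delta> * (- f x0 / (2 * \<delta>)) = - f x0 / 2" using \<delta> by simp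
        ultimately have \<epsilon>: "\<epsilon> < r^2" "\<delta> * \<epsilon> \<le> - f x0 / 2"
          using mult_left_mono[of \<epsilon> "- f x0 / (2 * \<delta>)" \<delta>] \<delta> by linarith+
        have "f x0 / (2 * \<delta>) < 0" using f0 \<delta> by (simp add: divide_neg_pos)
        then have \<epsilon>': "\<epsilon> > 0" "\<epsilon> \<le> (M - v x0) / 2"
          unfolding \<epsilon>_def using r(1) vlt by (simp, intro min.coboundedI2 order_refl)
        have vge: "v x \<ge> \<psi> x + (x - x0)^2" if "\<bar>x - x0\<bar> \<le> r" for x
          using r(2)[OF that] by (simp add: \<psi>_def)
        define w where "w x = (if \<bar>x - x0\<bar> \<le> r then max (v x) (\<psi> x + \<epsilon>) else v x)" for x
        have wv: "w x \<ge> v x" for x by (simp add: w_def)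
        have edge: "v x \<ge> \<psi> x + \<epsilon>" if "\<bar>x - x0\<bar> = r" for x
        proof -
          have "(x - x0)^2 = r^2" using that by (metis power2_abs)
          then show ?thesis using vge[of x] that \<epsilon>(1) by simp
        qed
        have w_cases: "w x = v x \<or> \<bar>x - x0\<bar> < r \<and> w x = \<psi> x + \<epsilon>" for x
          using edge[of x] by (cases "\<bar>x - x0\<bar> < r") (auto simp: w_def max_def)
        have "w \<in> S"
        proof (rule SI)
          have cl: "closed {x. \<bar>x - x0\<bar> \<le> r}" "closed {x. r \<le> \<bar>x - x0\<bar>}"
            by (intro closed_Collect_le continuous_intros)+
          have "continuous_on ({x. \<bar>x - x0\<bar> \<le> r} \<union> {x. r \<le> \<bar>x - x0\<bar>})
              (\<lambda>x. if \<bar>x - x0\<bar> \<le> r then max (v x) (\<psi> x + \<epsilon>) else v x)"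
          proof (rule continuous_on_cases[OF cl])
            show "continuous_on {x. \<bar>x - x0\<bar> \<le> r} (\<lambda>x. max (v x) (\<psi> x + \<epsilon>))"
              by (intro continuous_intros continuous_on_subset[OF cont] continuous_on_subset[OF c\<psi>]) auto
            show "continuous_on {x. r \<le> \<bar>x - x0\<bar>} v"
              by (rule continuous_on_subset[OF cont]) auto
          qed (auto intro!: max_absorb1 edge)
          moreover have "{x. \<bar>x - x0\<bar> \<le> r} \<union> {x. r \<le> \<bar>x - x0\<bar>} = UNIV" by auto
          ultimately show "continuous_on UNIV w" unfolding w_def[abs_def] by simp
          show "\<bar>w x\<bar> \<le> M" for x
          proof (cases "w x = v x")
            case True
            then show ?thesis using vM by simp
          next
            case False
            then have "\<bar>x - x0\<bar> < r" "w x = \<psi> x + \<epsilon>" using w_cases[of x] by auto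
            then have "w x \<le> M" using r(2)[of x] \<epsilon>'(2) by simp
            then show ?thesis using wv[of x] vM[of x] by linarith
          qed
          show "viscosity_subsolution (\<lambda>x q. \<delta> * w x + H (p + q) + V x) w"
          proof (rule viscosity_subsolutionI)
            fix \<eta> \<eta>' :: "real \<Rightarrow> real" and x1
            assume d\<eta>: "\<And>x. (\<eta> has_real_derivative \<eta>' x) (at x)" and c\<eta>: "continuous_on UNIV \<eta>'"
              and m\<eta>: "\<forall>\<^sub>F x in nhds x1. w x - \<eta> x \<le> w x1 - \<eta> x1"
            show "\<delta> * w x1 + H (p + \<eta>' x1) + V x1 \<le> 0"
            \<comment> \<open>Where \<open>w\<close> equals \<open>v\<close>, a test for
              \<open>w\<close> is a test for \<open>v\<close> because \<open>w \<ge> v\<close>.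
              Elsewhere \<open>w\<close> is the smooth bump near \<open>x1\<close>, which determines
              the slope of the test.\<close>
            proof (cases "w x1 = v x1")
              case True
              have "\<forall>\<^sub>F x in nhds x1. v x - \<eta> x \<le> v x1 - \<eta> x1"
                using m\<eta> by eventually_elim (use wv True in \<open>smt (verit)\<close>)
              from viscosity_subsolutionD[OF sub d\<eta> c\<eta> this] True show ?thesis by simp
            next
              case False
              then have x1: "\<bar>x1 - x0\<bar> < r" "w x1 = \<psi> x1 + \<epsilon>" using w_cases[of x1] by auto
              have "\<forall>\<^sub>F x in nhds x1. x \<in> {x0 - r<..<x0 + r}"
                using x1(1) by (intro eventually_nhds_in_open) (auto simp: abs_if split: if_splits)
              with m\<eta> have "\<forall>\<^sub>F x in nhds x1. \<psi> x - \<eta> x \<le> \<psi> x1 - \<eta> x1"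
              proof eventually_elim
                case (elim x)
                then have "\<bar>x - x0\<bar> \<le> r" by auto
                then have "w x \<ge> \<psi> x + \<epsilon>" by (simp add: w_def)
                then show ?case using elim(1) x1(2) by simp
              qed
              moreover have "(\<psi> has_real_derivative \<phi>' x1 - 2 * (x1 - x0)) (at x1)"
                unfolding \<psi>_def by (auto intro!: derivative_eq_intros d)
              ultimately have "\<eta>' x1 = \<phi>' x1 - 2 * (x1 - x0)"
                using derivative_eq_if_touching_above d\<eta> by blast
              then have "\<delta> * w x1 + H (p + \<eta>' x1) + V x1 = f x1 + \<delta> * \<epsilon>"
                by (simp add: f_def x1(2) distrib_left)
              also have "\<dots> \<le> 0" using r(2)[of x1] x1(1) \<epsilon>(2) by simp
              finally show ?thesis .
            qed
          qed
        qed
        from ge[OF this, of x0] show False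
          using \<epsilon>'(1) r(1) by (simp add: w_def \<psi>_def)
      qed
    qed
  qed
  have "\<delta> * \<bar>v x\<bar> \<le> B + \<bar>H p\<bar>" for x
    using mult_left_mono[OF vM[of x], of \<delta>] \<delta> M(2) by simp
  then show thesis using that per lip sub super by blast
qed

section \<open>Stability and the vanishing discount limit\<close>

text \<open>\<open>b\<close> stands for the discount term, which tends uniformly to
  \<open>- c\<close>. A point where the limit is touched is approximated by points where the
  approximants are touched, by \<open>perturbed_maximum\<close>, and the inequality passes to the
  limit by continuity.\<close>

lemma viscosity_subsolution_stable:
  fixes H V u :: "real \<Rightarrow> real"
  assumes H: "continuous_on UNIV H" and V: "continuous_on UNIV V"
    and approx: "\<And>e. e > 0 \<Longrightarrow> \<exists>w b. continuous_on UNIV w \<and> (\<forall>x. \<bar>w x - u x\<bar> < e) \<and> (\<forall>x. \<bar>b x + c\<bar> < e) \<and>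
      viscosity_subsolution (\<lambda>x q. b x + H (p + q) + V x) w"
  shows "viscosity_subsolution (\<lambda>x q. H (p + q) + V x - c) u"
proof (rule viscosity_subsolutionI)
  fix \<phi> \<phi>' :: "real \<Rightarrow> real" and x0
  assume d: "\<And>x. (\<phi> has_real_derivative \<phi>' x) (at x)" and c: "continuous_on UNIV \<phi>'"
    and m: "\<forall>\<^sub>F x in nhds x0. u x - \<phi> x \<le> u x0 - \<phi> x0"
  have c\<phi>: "continuous_on UNIV \<phi>" using d DERIV_continuous_on by blast
  define f where "f y = H (p + (\<phi>' y + 2 * (y - x0))) + V y - c" for y
  have cf: "continuous_on UNIV f"
    unfolding f_def by (intro continuous_intros continuous_on_compose2[OF H] c V) auto
  show "H (p + \<phi>' x0) + V x0 - c \<le> 0"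
  proof (rule ccontr)
    assume "\<not> ?thesis"
    then have f0: "f x0 > 0" by (simp add: f_def)
    have "(f \<longlongrightarrow> f x0) (nhds x0)"
      using cf by (simp add: continuous_on_eq_continuous_at isCont_def tendsto_nhds_iff)
    then have "\<forall>\<^sub>F y in nhds x0. f y > f x0 / 2"
      using f0 by (intro order_tendstoD) auto
    with m have "\<forall>\<^sub>F y in nhds x0. f y > f x0 / 2 \<and> u y - \<phi> y \<le> u x0 - \<phi> x0"
      by eventually_elim simp
    then obtain r where r: "r > 0"
      "\<And>y. \<bar>y - x0\<bar> \<le> r \<Longrightarrow> f y > f x0 / 2 \<and> u y - \<phi> y \<le> u x0 - \<phi> x0"
      unfolding eventually_nhds_metric_le dist_real_def by blast
    define \<epsilon> where "\<epsilon> = min (r^2 / 4) (f x0 / 2)"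
    have \<epsilon>: "\<epsilon> > 0" "\<epsilon> \<le> r^2 / 4" "\<epsilon> \<le> f x0 / 2"
      using r(1) f0 by (auto simp: \<epsilon>_def)
    have "r^2 > 0" using r(1) by simp
    then have \<epsilon>r: "2 * \<epsilon> < r^2" using \<epsilon> by linarith
    obtain w b where w: "continuous_on UNIV w" "\<And>x. \<bar>w x - u x\<bar> < \<epsilon>" "\<And>x. \<bar>b x + c\<bar> < \<epsilon>"
      "viscosity_subsolution (\<lambda>x q. b x + H (p + q) + V x) w"
      using approx[OF \<epsilon>(1)] by blast
    obtain y where y: "\<bar>y - x0\<bar> < r"
      "\<forall>\<^sub>F x in nhds y. w x - (\<phi> x + (x - x0)^2) \<le> w y - (\<phi> y + (y - x0)^2)"
    proof (rule perturbed_maximum[OF w(1) c\<phi> r(1) \<epsilon>r, of x0 u])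
      show "w x \<le> u x + \<epsilon>" for x using w(2)[of x] by linarith
      show "u x0 - \<epsilon> \<le> w x0" using w(2)[of x0] by linarith
    qed (use r(2) that in auto)
    have "b y + H (p + (\<phi>' y + 2 * (y - x0))) + V y \<le> 0"
    proof (rule viscosity_subsolutionD[OF w(4), where z = y and \<phi> = "\<lambda>x. \<phi> x + (x - x0)^2"
          and \<phi>' = "\<lambda>y. \<phi>' y + 2 * (y - x0)"])
      show "((\<lambda>x. \<phi> x + (x - x0)^2) has_real_derivative \<phi>' x + 2 * (x - x0)) (at x)" for x
        by (auto intro!: derivative_eq_intros d)
    qed (use y(2) in \<open>auto intro!: continuous_intros c\<close>)
    then have "f y < \<epsilon>" using w(3)[of y] unfolding f_def[of y] by linarith
    then show False using r(2)[of y] y(1) \<epsilon>(3) by simp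
  qed
qed

text \<open>Duality sends \<open>H\<close>, \<open>p\<close>, \<open>V\<close>, \<open>c\<close> to
  \<open>\<lambda>t. - H (- t)\<close>, \<open>- p\<close>, \<open>- V\<close>, \<open>- c\<close>;
  continuity survives the reflection, so the subsolution case applies.\<close>

lemma viscosity_supersolution_stable:
  fixes H V u :: "real \<Rightarrow> real"
  assumes H: "continuous_on UNIV H" and V: "continuous_on UNIV V"
    and approx: "\<And>e. e > 0 \<Longrightarrow> \<exists>w b. continuous_on UNIV w \<and> (\<forall>x. \<bar>w x - u x\<bar> < e) \<and> (\<forall>x. \<bar>b x + c\<bar> < e) \<and>
      viscosity_supersolution (\<lambda>x q. b x + H (p + q) + V x) w"
  shows "viscosity_supersolution (\<lambda>x q. H (p + q) + V x - c) u"
proof -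
  have "viscosity_subsolution (\<lambda>x q. - H (- (- p + q)) + - V x - - c) (\<lambda>x. - u x)"
  proof (rule viscosity_subsolution_stable[where H = "\<lambda>t. - H (- t)" and V = "\<lambda>x. - V x"])
    show "continuous_on UNIV (\<lambda>t. - H (- t))" "continuous_on UNIV (\<lambda>x. - V x)"
      by (intro continuous_intros continuous_on_compose2[OF H] V; simp)+
    fix e :: real assume "e > 0"
    then obtain w b where w: "continuous_on UNIV w" "\<And>x. \<bar>w x - u x\<bar> < e" "\<And>x. \<bar>b x + c\<bar> < e"
      "viscosity_supersolution (\<lambda>x q. b x + H (p + q) + V x) w"
      using approx by blast
    show "\<exists>w b. continuous_on UNIV w \<and> (\<forall>x. \<bar>w x - - u x\<bar> < e) \<and> (\<forall>x. \<bar>b x + - c\<bar> < e) \<and>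
      viscosity_subsolution (\<lambda>x q. b x + - H (- (- p + q)) + - V x) w"
    proof (intro exI conjI allI)
      show "continuous_on UNIV (\<lambda>x. - w x)" using w(1) by (rule continuous_on_minus)
      show "\<bar>- w x - - u x\<bar> < e" for x using w(2)[of x] by linarith
      show "\<bar>- b x + - c\<bar> < e" for x using w(3)[of x] by linarith
      show "viscosity_subsolution (\<lambda>x q. - b x + - H (- (- p + q)) + - V x) (\<lambda>x. - w x)"
        using w(4) unfolding viscosity_supersolution_iff_neg by (simp add: algebra_simps)
    qed
  qed
  then show ?thesis
    unfolding viscosity_supersolution_iff_neg by (simp add: algebra_simps)
qed

text \<open>Arzela-Ascoli on one period; periodicity spreads the uniform convergence over the whole
  line.\<close>

lemma equi_lipschitz_periodic_limit:
  fixes w :: "nat \<Rightarrow> real \<Rightarrow> real"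
  assumes per: "\<And>n. periodic1 (w n)" and lip: "\<And>n x y. \<bar>w n x - w n y\<bar> \<le> L * \<bar>x - y\<bar>"
    and w0: "\<And>n. w n 0 = 0" and L: "L \<ge> 0"
  obtains u k where "u \<in> C_torus" "strict_mono (k :: nat \<Rightarrow> nat)"
    "\<And>e. e > 0 \<Longrightarrow> \<exists>N. \<forall>n\<ge>N. \<forall>x. \<bar>w (k n) x - u x\<bar> < e"
proof -
  have bd: "\<bar>w n x\<bar> \<le> L" if "x \<in> {0..1}" for n x
    using lip[of n x 0] w0[of n] mult_left_mono[of "\<bar>x\<bar>" 1 L] that L by auto
  obtain g k where gk: "continuous_on {0..1} g" "strict_mono (k :: nat \<Rightarrow> nat)"
    "\<And>e. 0 < e \<Longrightarrow> \<exists>N. \<forall>n x. n \<ge> N \<and> x \<in> {0..1} \<longrightarrow> norm (w (k n) x - g x) < e"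
  proof (rule Arzela_Ascoli[of "{0..1::real}" w L])
    fix x e :: real assume "e > 0"
    have "\<bar>w n x - w n y\<bar> < e" if "\<bar>x - y\<bar> < e / (L + 1)" for n y
    proof -
      have "L * \<bar>x - y\<bar> \<le> (L + 1) * \<bar>x - y\<bar>" by (simp add: algebra_simps)
      also have "\<dots> < e" using that L by (simp add: field_simps)
      finally show ?thesis using lip[of n x y] by linarith
    qed
    then show "\<exists>d>0. \<forall>n y. y \<in> {0..1} \<and> norm (x - y) < d \<longrightarrow> norm (w n x - w n y) < e"
      using \<open>e > 0\<close> L by (intro exI[of _ "e / (L + 1)"]) auto
  qed (use bd in auto)
  \<comment> \<open>Continuity across the integers is not visible in this formula; it comes from the
    Lipschitz bound, which survives uniform convergence.\<close>
  define u where "u x = g (frac x)" for x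
  have unif: "\<exists>N. \<forall>n\<ge>N. \<forall>x. \<bar>w (k n) x - u x\<bar> < e" if "e > 0" for e
  proof -
    obtain N where N: "\<And>n x. n \<ge> N \<Longrightarrow> x \<in> {0..1} \<Longrightarrow> \<bar>w (k n) x - g x\<bar> < e"
      using gk(3)[OF \<open>e > 0\<close>] by auto
    have "\<bar>w (k n) x - u x\<bar> < e" if "n \<ge> N" for n x
      using N[OF that, of "frac x"] periodic1_frac[OF per[of "k n"], of x]
      by (simp add: u_def frac_ge_0 frac_lt_1 less_imp_le)
    then show ?thesis by blast
  qed
  have "\<bar>u x - u y\<bar> \<le> L * \<bar>x - y\<bar>" for x y
  proof (rule field_le_epsilon)
    fix e :: real assume "e > 0"
    then obtain N where "\<And>x. \<bar>w (k N) x - u x\<bar> < e / 2"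
      using unif[of "e / 2"] by auto
    from this[of x] this[of y] lip[of "k N" x y] show "\<bar>u x - u y\<bar> \<le> L * \<bar>x - y\<bar> + e"
      by linarith
  qed
  then have "continuous_on UNIV u"
    by (intro lipschitz_on_continuous_on[of L]) (use L in \<open>auto simp: lipschitz_on_def dist_real_def\<close>)
  moreover have "periodic1 u" by (simp add: periodic1_def u_def frac_def)
  ultimately show thesis
    using that[of u k] gk(2) unif by (simp add: C_torus_def)
qed

text \<open>Vanishing discount: the discounted solutions, normalised to vanish at 0, share a
  Lipschitz constant and converge along a subsequence. Their discount terms flatten to a constant,
  whose negative is \<open>c\<close>.\<close>

theorem cell_problem_solvable:
  assumes H: "continuous_on UNIV H" "coercive H" and V: "V \<in> C_torus"
  obtains c v where "cell_problem_solution H V p c v"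
proof -
  obtain B where B: "B > 0" "\<And>x. \<bar>V x\<bar> \<le> B" using C_torus_bounded[OF V] by blast
  have contV: "continuous_on UNIV V" using V by (simp add: C_torus_def)
  have "\<forall>\<^sub>F q in at_infinity. H q > 2 * B + \<bar>H p\<bar>"
    using H(2) unfolding coercive_def filterlim_at_top_dense by blast
  then obtain b where b: "\<And>q. b \<le> \<bar>q\<bar> \<Longrightarrow> H q > 2 * B + \<bar>H p\<bar>"
    unfolding eventually_at_infinity by auto
  \<comment> \<open>The level \<open>2 * B + \<bar>H p\<bar>\<close> is free of the discount, so one
    \<open>L\<close> serves all \<open>n\<close>.\<close>
  define L where "L = \<bar>b\<bar> + \<bar>p\<bar>"
  have L: "\<bar>q\<bar> \<le> L" if "H (p + q) \<le> 2 * B + \<bar>H p\<bar>" for q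
  proof -
    have "\<bar>p + q\<bar> < b" using b[of "p + q"] that by (meson not_less)
    then show ?thesis unfolding L_def by linarith
  qed
  have L0: "L \<ge> 0" by (simp add: L_def)
  define \<delta> where "\<delta> n = inverse (real (Suc n))" for n
  have \<delta>: "\<delta> n > 0" for n by (simp add: \<delta>_def)
  define good where "good n v \<longleftrightarrow> periodic1 v \<and> (\<forall>x y. \<bar>v x - v y\<bar> \<le> L * \<bar>x - y\<bar>) \<and>
    (\<forall>x. \<delta> n * \<bar>v x\<bar> \<le> B + \<bar>H p\<bar>) \<and>
    viscosity_subsolution (\<lambda>x q. \<delta> n * v x + H (p + q) + V x) v \<and>
    viscosity_supersolution (\<lambda>x q. \<delta> n * v x + H (p + q) + V x) v" for n v
  have "\<exists>v. good n v" for n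
  proof (rule discounted_solution_exists[OF H(1) V B(2) less_imp_le[OF B(1)] \<delta>[of n] L0 L])
    fix v :: "real \<Rightarrow> real"
    assume "periodic1 v" "\<And>x y. \<bar>v x - v y\<bar> \<le> L * \<bar>x - y\<bar>" "\<And>x. \<delta> n * \<bar>v x\<bar> \<le> B + \<bar>H p\<bar>"
      "viscosity_subsolution (\<lambda>x q. \<delta> n * v x + H (p + q) + V x) v"
      "viscosity_supersolution (\<lambda>x q. \<delta> n * v x + H (p + q) + V x) v"
    then have "good n v" by (simp add: good_def)
    then show "\<exists>v. good n v" by blast
  qed
  then obtain v where "\<And>n. good n (v n)" by metis
  then have v: "\<And>n. periodic1 (v n)" "\<And>n x y. \<bar>v n x - v n y\<bar> \<le> L * \<bar>x - y\<bar>"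
    "\<And>n x. \<delta> n * \<bar>v n x\<bar> \<le> B + \<bar>H p\<bar>"
    "\<And>n. viscosity_subsolution (\<lambda>x q. \<delta> n * v n x + H (p + q) + V x) (v n)"
    "\<And>n. viscosity_supersolution (\<lambda>x q. \<delta> n * v n x + H (p + q) + V x) (v n)"
    by (simp_all add: good_def)
  define w where "w n x = v n x - v n 0" for n x
  have lipw: "\<bar>w n x - w n y\<bar> \<le> L * \<bar>x - y\<bar>" for n x y
    using v(2) by (simp add: w_def)
  have perw: "periodic1 (w n)" for n
    using v(1)[of n] by (simp add: w_def periodic1_def)
  obtain u k where u: "u \<in> C_torus" and k: "strict_mono (k :: nat \<Rightarrow> nat)"
    and unif: "\<And>e. e > 0 \<Longrightarrow> \<exists>N. \<forall>n\<ge>N. \<forall>x. \<bar>w (k n) x - u x\<bar> < e"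
    using equi_lipschitz_periodic_limit[of w L, OF perw lipw _ L0] by (auto simp: w_def)
  have wL: "\<bar>w n x\<bar> \<le> L" for n x
  proof -
    have "\<bar>w n (frac x) - w n 0\<bar> \<le> L * \<bar>frac x - 0\<bar>" by (rule lipw)
    also have "\<dots> \<le> L * 1"
      using L0 frac_lt_1[of x] frac_ge_0[of x] by (intro mult_left_mono) auto
    finally show ?thesis
      using periodic1_frac[OF perw[of n], of x] by (simp add: w_def)
  qed
  have "\<bar>\<delta> (k n) * v (k n) 0\<bar> \<le> B + \<bar>H p\<bar>" for n
    using v(3)[of "k n" 0] \<delta>[of "k n"] by (simp add: abs_mult)
  then have "\<delta> (k n) * v (k n) 0 \<in> {- (B + \<bar>H p\<bar>)..B + \<bar>H p\<bar>}" for n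
    unfolding atLeastAtMost_iff by (metis abs_le_iff minus_le_iff)
  then obtain l j where j: "strict_mono (j :: nat \<Rightarrow> nat)"
    "((\<lambda>n. \<delta> (k n) * v (k n) 0) \<circ> j) \<longlonglongrightarrow> l"
    using compact_Icc[of "- (B + \<bar>H p\<bar>)" "B + \<bar>H p\<bar>"] unfolding compact_def by meson
  define c where "c = - l"
  \<comment> \<open>\<open>\<delta> n * v n x\<close> is \<open>\<delta> n * v n 0\<close>, which
    tends to \<open>l = - c\<close> along the second subsequence, plus
    \<open>\<delta> n * w n x\<close>, which is at most \<open>\<delta> n * L\<close> in absolute
    value and tends to 0.\<close>
  have approx: "\<exists>n. (\<forall>x. \<bar>w n x - u x\<bar> < e) \<and> (\<forall>x. \<bar>\<delta> n * v n x + c\<bar> < e)" if e: "e > 0" for e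
  proof -
    obtain N where N: "\<And>n x. n \<ge> N \<Longrightarrow> \<bar>w (k n) x - u x\<bar> < e"
      using unif[OF e] by blast
    have "strict_mono (k \<circ> j)" using k j(1) by (rule strict_mono_o)
    have "\<forall>\<^sub>F n in sequentially. \<bar>\<delta> (k (j n)) * v (k (j n)) 0 - l\<bar> < e / 2"
      using j(2) e unfolding tendsto_iff dist_real_def comp_def by (metis half_gt_zero)
    moreover have "(\<lambda>n. \<delta> (k (j n)) * L) \<longlonglongrightarrow> 0"
    proof -
      have "\<delta> \<longlonglongrightarrow> 0" unfolding \<delta>_def by (rule LIMSEQ_inverse_real_of_nat)
      then have "(\<delta> \<circ> (k \<circ> j)) \<longlonglongrightarrow> 0" by (rule LIMSEQ_subseq_LIMSEQ) fact
      from tendsto_mult_left_zero[OF this, of L] show ?thesis by (simp add: comp_def)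
    qed
    then have "\<forall>\<^sub>F n in sequentially. \<delta> (k (j n)) * L < e / 2"
      using e by (intro order_tendstoD(2)) auto
    moreover have "\<forall>\<^sub>F n in sequentially. n \<ge> N" by (rule eventually_ge_at_top)
    ultimately have "\<forall>\<^sub>F n in sequentially. \<bar>\<delta> (k (j n)) * v (k (j n)) 0 - l\<bar> < e / 2 \<and>
        \<delta> (k (j n)) * L < e / 2 \<and> n \<ge> N"
      by eventually_elim simp
    then obtain n where n: "\<bar>\<delta> (k (j n)) * v (k (j n)) 0 - l\<bar> < e / 2" "\<delta> (k (j n)) * L < e / 2" "n \<ge> N"
      by (auto simp: eventually_sequentially)
    have "j n \<ge> N" using n(3) strict_mono_imp_increasing[OF j(1), of n] by simp
    have "\<bar>\<delta> (k (j n)) * v (k (j n)) x + c\<bar> < e" for x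
    proof -
      have "\<delta> (k (j n)) * v (k (j n)) x + c =
          \<delta> (k (j n)) * w (k (j n)) x + (\<delta> (k (j n)) * v (k (j n)) 0 - l)"
        by (simp add: w_def c_def algebra_simps)
      moreover have "\<bar>\<delta> (k (j n)) * w (k (j n)) x\<bar> \<le> \<delta> (k (j n)) * L"
        using wL[of "k (j n)" x] \<delta>[of "k (j n)"] by (simp add: abs_mult)
      ultimately show ?thesis using n by linarith
    qed
    then show ?thesis using N[OF \<open>j n \<ge> N\<close>] by blast
  qed
  \<comment> \<open>\<open>w n\<close> and \<open>v n\<close> differ by a constant, so their germs
    agree with factor 1.\<close>
  have germ: "\<exists>y. (\<forall>q. \<delta> n * v n x + H (p + q) + V x = \<delta> n * v n y + H (p + q) + V y) \<and>
      germ_similar 1 (w n) x (v n) y \<and> germ_similar (- 1) (w n) x (v n) y" for n x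
    by (intro exI[of _ x] conjI; (simp; fail)?)
      (auto simp: germ_similar_def w_def intro!: exI[of _ "1::real"])
  have contw: "continuous_on UNIV (w n)" for n
    by (rule lipschitz_on_continuous_on[of L])
      (use lipw L0 in \<open>auto simp: lipschitz_on_def dist_real_def\<close>)
  have "viscosity_subsolution (\<lambda>x q. H (p + q) + V x - c) u"
  proof (rule viscosity_subsolution_stable[OF H(1) contV])
    fix e :: real assume "e > 0"
    from approx[OF this] obtain n where n: "\<And>x. \<bar>w n x - u x\<bar> < e" "\<And>x. \<bar>\<delta> n * v n x + c\<bar> < e" by blast
    have "viscosity_subsolution (\<lambda>x q. \<delta> n * v n x + H (p + q) + V x) (w n)"
      by (rule viscosity_subsolution_rescale[OF v(4) germ])
    with n contw show "\<exists>w b. continuous_on UNIV w \<and> (\<forall>x. \<bar>w x - u x\<bar> < e) \<and> (\<forall>x. \<bar>b x + c\<bar> < e) \<and>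
      viscosity_subsolution (\<lambda>x q. b x + H (p + q) + V x) w"
      by (intro exI[of _ "w n"] exI[of _ "\<lambda>x. \<delta> n * v n x"]) auto
  qed
  moreover have "viscosity_supersolution (\<lambda>x q. H (p + q) + V x - c) u"
  proof (rule viscosity_supersolution_stable[OF H(1) contV])
    fix e :: real assume "e > 0"
    from approx[OF this] obtain n where n: "\<And>x. \<bar>w n x - u x\<bar> < e" "\<And>x. \<bar>\<delta> n * v n x + c\<bar> < e" by blast
    have "viscosity_supersolution (\<lambda>x q. \<delta> n * v n x + H (p + q) + V x) (w n)"
      by (rule viscosity_supersolution_rescale[OF v(5) germ])
    with n contw show "\<exists>w b. continuous_on UNIV w \<and> (\<forall>x. \<bar>w x - u x\<bar> < e) \<and> (\<forall>x. \<bar>b x + c\<bar> < e) \<and>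
      viscosity_supersolution (\<lambda>x q. b x + H (p + q) + V x) w"
      by (intro exI[of _ "w n"] exI[of _ "\<lambda>x. \<delta> n * v n x"]) auto
  qed
  ultimately have "cell_problem_solution H V p c u"
    using u by (simp add: cell_problem_solution_def viscosity_solution_def)
  then show thesis by (rule that)
qed

text \<open>A solution is both a sub- and a supersolution, so comparison in both directions
  identifies any two admissible constants.\<close>

lemma effective_hamiltonian_eqI:
  assumes "cell_problem_solution H V p c v" and V: "V \<in> C_torus"
  shows "effective_hamiltonian H V p = c"
  unfolding effective_hamiltonian_def
proof (rule the_equality)
  show "\<exists>v. cell_problem_solution H V p c v" using assms by blast
  fix c' assume "\<exists>v. cell_problem_solution H V p c' v"
  then obtain v' where "cell_problem_solution H V p c' v'" ..
  with assms(1) show "c' = c"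
    unfolding cell_problem_solution_def viscosity_solution_def
    using cell_comparison[OF _ _ V, of v v' H p c c'] cell_comparison[OF _ _ V, of v' v H p c' c]
    by simp
qed

lemma effective_hamiltonian_solution:
  assumes "continuous_on UNIV H" "coercive H" "V \<in> C_torus"
  obtains v where "cell_problem_solution H V p (effective_hamiltonian H V p) v"
  using cell_problem_solvable[OF assms, of p] effective_hamiltonian_eqI[OF _ assms(3)] by metis

subsection \<open>Sawtooth potentials\<close>

lemma partition_cover_left_closed:
  fixes b :: "nat \<Rightarrow> real"
  assumes "b 0 \<le> x" "x < b n"
  shows "\<exists>i<n. b i \<le> x \<and> x < b (Suc i)"
  using assms
proof (induction n)
  case (Suc n)
  show ?case
  proof (cases "x < b n")
    case True
    with Suc show ?thesis using less_Suc_eq by blast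
  next
    case False
    then show ?thesis using Suc.prems by (intro exI[of _ n]) auto
  qed
qed simp

text \<open>The extension has the form of a linear function plus a periodic one. The formula holds
  on closed unit cells, so that at an integer it is available from both sides.\<close>

lemma quasi_periodic_extension:
  fixes f :: "real \<Rightarrow> real"
  assumes f: "continuous_on {0..1} f" "f 1 = f 0 + p"
  obtains u where "continuous_on UNIV u" "\<And>x. u (x + 1) = u x + p"
    "\<And>(k::int) x. x \<in> {of_int k..of_int k + 1} \<Longrightarrow> u x = f (x - of_int k) + p * of_int k"
proof
  define u where "u x = f (frac x) + p * of_int \<lfloor>x\<rfloor>" for x
  show eq: "u x = f (x - of_int k) + p * of_int k" if "x \<in> {of_int k..of_int k + 1}" for x and k :: int
  proof (cases "x = of_int k + 1")
    case True
    then have "x = of_int (k + 1)" by simp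
    then have "\<lfloor>x\<rfloor> = k + 1" "frac x = 0" by (simp_all only: floor_of_int frac_of_int)
    then show ?thesis using True f(2) by (simp add: u_def algebra_simps)
  next
    case False
    then have "\<lfloor>x\<rfloor> = k" using that by (simp add: floor_eq_iff)
    then show ?thesis by (simp add: u_def frac_def)
  qed
  show "u (x + 1) = u x + p" for x
    by (simp add: u_def frac_def algebra_simps)
  have seg: "continuous_on {of_int k..of_int k + 1} u" for k :: int
  proof (rule continuous_on_eq)
    show "continuous_on {of_int k..of_int k + 1} (\<lambda>x. f (x - of_int k) + p * of_int k)"
      by (intro continuous_intros continuous_on_compose2[OF f(1)]) auto
  qed (use eq in simp)
  have "isCont u x" for x
  proof -
    define k where "k = \<lfloor>x\<rfloor>"
    \<comment> \<open>Two adjacent cells are joined because \<open>x\<close> may be the common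
      endpoint \<open>of_int k\<close>.\<close>
    have "continuous_on ({of_int (k - 1)..of_int (k - 1) + 1} \<union> {of_int k..of_int k + 1}) u"
      by (intro continuous_on_closed_Un seg closed_atLeastAtMost)
    moreover have "{of_int (k - 1)<..<of_int k + 1} \<subseteq> {of_int (k - 1)..of_int (k - 1) + 1} \<union> {of_int k..of_int k + 1 :: real}"
      by auto
    ultimately have "continuous_on {of_int (k - 1)<..<of_int k + 1} u"
      by (rule continuous_on_subset)
    moreover have "of_int k \<le> x" "x < of_int k + 1"
      unfolding k_def by (rule of_int_floor_le, rule floor_correct[THEN conjunct2, simplified])
    then have "x \<in> {of_int (k - 1)<..<of_int k + 1}" by simp
    ultimately show ?thesis
      using continuous_on_eq_continuous_at[OF open_greaterThanLessThan] by blast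
  qed
  then show "continuous_on UNIV u" by (simp add: continuous_at_imp_continuous_on)
qed

text \<open>Only increments over each piece are prescribed; starting each piece at the end value of
  the previous one fixes the additive constants.\<close>

lemma concatenate_increments:
  fixes b :: "nat \<Rightarrow> real" and g :: "nat \<Rightarrow> real \<Rightarrow> real"
  assumes "\<And>i. i < n \<Longrightarrow> b i < b (Suc i)" "\<And>i. i < n \<Longrightarrow> g i (b i) = 0"
    and "\<And>i. i < n \<Longrightarrow> continuous_on {b i..b (Suc i)} (g i)"
  shows "\<exists>f. continuous_on {b 0..b n} f \<and> f (b 0) = 0 \<and> f (b n) = (\<Sum>i<n. g i (b (Suc i))) \<and>
    (\<forall>i<n. \<forall>x\<in>{b i..b (Suc i)}. f x = f (b i) + g i x)"
  using assms
proof (induction n)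
  case 0
  show ?case by (intro exI[of _ "\<lambda>_. 0"]) simp
next
  case (Suc n)
  have mono: "b i \<le> b j" if "i \<le> j" "j \<le> Suc n" for i j
    using that
  proof (induction rule: dec_induct)
    case (step k)
    then show ?case using Suc.prems(1)[of k] by simp
  qed simp
  have "\<exists>f. continuous_on {b 0..b n} f \<and> f (b 0) = 0 \<and> f (b n) = (\<Sum>i<n. g i (b (Suc i))) \<and>
      (\<forall>i<n. \<forall>x\<in>{b i..b (Suc i)}. f x = f (b i) + g i x)"
    by (rule Suc.IH) (auto intro: Suc.prems)
  then obtain f where f: "continuous_on {b 0..b n} f" "f (b 0) = 0" "f (b n) = (\<Sum>i<n. g i (b (Suc i)))"
    "\<And>i x. i < n \<Longrightarrow> x \<in> {b i..b (Suc i)} \<Longrightarrow> f x = f (b i) + g i x"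
    by blast
  define F where "F x = (if x \<le> b n then f x else f (b n) + g n x)" for x
  have gn: "g n (b n) = 0" "b n < b (Suc n)" using Suc.prems by auto
  have "continuous_on ({b 0..b n} \<union> {b n..b (Suc n)}) F"
    unfolding F_def[abs_def]
    by (rule continuous_on_cases) (use f(1) Suc.prems(3)[of n] gn in \<open>auto intro!: continuous_intros\<close>)
  moreover have "{b 0..b n} \<union> {b n..b (Suc n)} = {b 0..b (Suc n)}"
    using mono[of 0 n] gn by auto
  ultimately have "continuous_on {b 0..b (Suc n)} F" by simp
  moreover have "F x = F (b i) + g i x" if "i < Suc n" "x \<in> {b i..b (Suc i)}" for i x
  proof (cases "i < n")
    case True
    then have "b i \<le> b n" "b (Suc i) \<le> b n" using mono by auto
    then show ?thesis using f(4)[OF True that(2)] that(2) by (simp add: F_def)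
  next
    case False
    then have "i = n" using that by simp
    then show ?thesis using that gn by (auto simp: F_def)
  qed
  moreover have "F (b 0) = 0" using f(2) mono[of 0 n] by (simp add: F_def)
  moreover have "F (b (Suc n)) = (\<Sum>i<Suc n. g i (b (Suc i)))"
    using gn f(3) by (simp add: F_def)
  ultimately show ?case by blast
qed

text \<open>Zero-based description of the many-toothed potential: \<open>n\<close> teeth with peaks
  \<open>b i\<close> at height 0 and valleys \<open>d i\<close> at height -1, in explicit
  interpolation formulas.\<close>

definition sawtooth :: "nat \<Rightarrow> (nat \<Rightarrow> real) \<Rightarrow> (nat \<Rightarrow> real) \<Rightarrow> (real \<Rightarrow> real) \<Rightarrow> bool" where
  "sawtooth n b d V \<longleftrightarrow> V \<in> C_torus \<and> b 0 = 0 \<and> b n = 1 \<and>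
     (\<forall>i<n. b i < d i \<and> d i < b (Suc i) \<and>
        (\<forall>x\<in>{b i..d i}. V x = - ((x - b i) / (d i - b i))) \<and>
        (\<forall>x\<in>{d i..b (Suc i)}. V x = - ((b (Suc i) - x) / (b (Suc i) - d i))))"

definition tent :: "real \<Rightarrow> (real \<Rightarrow> real) \<Rightarrow> bool" where
  "tent s V \<longleftrightarrow> V \<in> C_torus \<and> (\<forall>x\<in>{0..s}. V x = - (x / s)) \<and>
     (\<forall>x\<in>{s..1}. V x = (x - 1) / (1 - s))"

lemma cell_problem_solution_iff_add_linear:
  "cell_problem_solution H V p c v \<longleftrightarrow> v \<in> C_torus \<and>
     viscosity_solution (\<lambda>x q. H q + V x - c) (\<lambda>x. p * x + v x)"
  using viscosity_subsolution_add_linear[of "\<lambda>x q. H q + V x - c" p v]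
    viscosity_supersolution_add_linear[of "\<lambda>x q. H q + V x - c" p v]
  by (simp add: cell_problem_solution_def viscosity_solution_def)

lemma germ_similarI:
  assumes "r > 0" "e > 0"
    and "\<And>h. 0 < h \<Longrightarrow> h < e \<Longrightarrow> u (x + \<sigma> * h) - u x = r * (w (y + \<sigma> * h / r) - w y)"
  shows "germ_similar \<sigma> u x w y"
  unfolding germ_similar_def eventually_at_right_field using assms by auto

text \<open>On each tooth \<open>V1\<close> is a rescaling of the two pieces of \<open>V2\<close>,
  so rescaled pieces of \<open>w\<close> solve the equation there with unchanged slopes. The factors
  sum to 1 over the descending pieces and to 1 over the ascending ones exactly because of
  \<open>total\<close>, so the increment over a period is still \<open>p\<close>.\<close>

lemma cell_problem_solution_sawtooth:
  assumes s: "0 < s" "s < 1" and tent: "tent s V2" and saw: "sawtooth n b d V1"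
    and total: "(\<Sum>i<n. d i - b i) = s" and sol: "cell_problem_solution H V2 p c v2"
  shows "\<exists>v1. cell_problem_solution H V1 p c v1"
proof -
  define w where "w x = p * x + v2 x" for x
  have contw: "continuous_on UNIV w"
    unfolding w_def using sol
    by (intro continuous_intros) (simp add: cell_problem_solution_def C_torus_def)
  have w1: "w (x + 1) = w x + p" for x
    using sol by (simp add: w_def cell_problem_solution_def C_torus_def periodic1_def distrib_left)
  have w_sol: "viscosity_solution (\<lambda>x q. H q + V2 x - c) w"
    using sol unfolding w_def cell_problem_solution_iff_add_linear by blast
  have b0: "b 0 = 0" and bn: "b n = 1"
    and bd: "\<And>i. i < n \<Longrightarrow> b i < d i" "\<And>i. i < n \<Longrightarrow> d i < b (Suc i)"
    and V1: "V1 \<in> C_torus"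
    and V1l: "\<And>i x. i < n \<Longrightarrow> x \<in> {b i..d i} \<Longrightarrow> V1 x = - ((x - b i) / (d i - b i))"
    and V1r: "\<And>i x. i < n \<Longrightarrow> x \<in> {d i..b (Suc i)} \<Longrightarrow> V1 x = - ((b (Suc i) - x) / (b (Suc i) - d i))"
    using saw by (auto simp: sawtooth_def)
  have V2l: "\<And>x. x \<in> {0..s} \<Longrightarrow> V2 x = - (x / s)" and V2r: "\<And>x. x \<in> {s..1} \<Longrightarrow> V2 x = (x - 1) / (1 - s)"
    using tent by (auto simp: tent_def)
  \<comment> \<open>Ratios of the lengths of the two pieces of tooth \<open>i\<close> to the
    corresponding lengths \<open>s\<close> and \<open>1 - s\<close> of the tent.\<close>
  define l r where "l i = (d i - b i) / s" and "r i = (b (Suc i) - d i) / (1 - s)" for i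
  have lr: "l i > 0" "r i > 0" if "i < n" for i
    using bd[OF that] s by (auto simp: l_def r_def)
  have ls: "(d i - b i) / l i = s" "(b (Suc i) - d i) / r i = 1 - s" if "i < n" for i
    using bd[OF that] s by (auto simp: l_def r_def)
  define g where "g i x = (if x \<le> d i then l i * (w ((x - b i) / l i) - w 0)
      else l i * (w s - w 0) + r i * (w (s + (x - d i) / r i) - w s))" for i x
  have gd: "g i x = l i * (w s - w 0) + r i * (w (s + (x - d i) / r i) - w s)"
    if "i < n" "x \<ge> d i" for i x
    using that ls(1)[OF that(1)] by (cases "x = d i") (auto simp: g_def)
  have "\<exists>f. continuous_on {b 0..b n} f \<and> f (b 0) = 0 \<and> f (b n) = (\<Sum>i<n. g i (b (Suc i))) \<and>
    (\<forall>i<n. \<forall>x\<in>{b i..b (Suc i)}. f x = f (b i) + g i x)"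
  proof (rule concatenate_increments)
    fix i assume i: "i < n"
    show "b i < b (Suc i)" using bd[OF i] by simp
    show "g i (b i) = 0" using bd[OF i] by (simp add: g_def)
    have "continuous_on ({b i..d i} \<union> {d i..b (Suc i)}) (g i)"
      unfolding g_def[abs_def]
      by (rule continuous_on_cases)
        (use ls(1)[OF i] lr[OF i] in \<open>auto intro!: continuous_intros continuous_on_compose2[OF contw]\<close>)
    moreover have "{b i..d i} \<union> {d i..b (Suc i)} = {b i..b (Suc i)}" using bd[OF i] by auto
    ultimately show "continuous_on {b i..b (Suc i)} (g i)" by simp
  qed
  then obtain f where f: "continuous_on {0..1} f" "f 0 = 0" "f 1 = (\<Sum>i<n. g i (b (Suc i)))"
    "\<And>i x. i < n \<Longrightarrow> x \<in> {b i..b (Suc i)} \<Longrightarrow> f x = f (b i) + g i x"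
    unfolding b0 bn by blast
  have "g i (b (Suc i)) = l i * (w s - w 0) + r i * (w 1 - w s)" if "i < n" for i
    using gd[OF that, of "b (Suc i)"] bd[OF that] ls(2)[OF that] by simp
  then have "f 1 = (\<Sum>i<n. l i * (w s - w 0) + r i * (w 1 - w s))"
    unfolding f(3) by (intro sum.cong) auto
  also have "\<dots> = (\<Sum>i<n. l i) * (w s - w 0) + (\<Sum>i<n. r i) * (w 1 - w s)"
    by (simp add: sum.distrib sum_distrib_right)
  also have "(\<Sum>i<n. l i) = 1"
    using total s by (simp add: l_def sum_divide_distrib[symmetric])
  also have "(\<Sum>i<n. r i) = 1"
  proof -
    have "(\<Sum>i<n. b (Suc i) - d i) = (\<Sum>i<n. b (Suc i) - b i) - (\<Sum>i<n. d i - b i)"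
      by (simp add: sum_subtractf[symmetric])
    also have "\<dots> = 1 - s" using total b0 bn by (simp add: sum_lessThan_telescope)
    finally show ?thesis using s by (simp add: r_def sum_divide_distrib[symmetric])
  qed
  also have "1 * (w s - w 0) + 1 * (w 1 - w s) = p" using w1[of 0] by simp
  finally have "f 1 = f 0 + p" using f(2) by simp
  then obtain u where u: "continuous_on UNIV u" "\<And>x. u (x + 1) = u x + p"
    "\<And>(k::int) x. x \<in> {of_int k..of_int k + 1} \<Longrightarrow> u x = f (x - of_int k) + p * of_int k"
    using quasi_periodic_extension[OF f(1)] by metis
  have bmono: "b i \<le> b j" if "i \<le> j" "j \<le> n" for i j
    using that
  proof (induction rule: dec_induct)
    case (step k)
    then show ?case using bd[of k] by simp
  qed simp
  \<comment> \<open>Differences within one tooth do not see the constants \<open>f (b i)\<close> and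
    \<open>p * of_int k\<close>, so germs of \<open>u\<close> can be read off from
    \<open>g i\<close>.\<close>
  have incr: "u (of_int k + x) - u (of_int k + z) = g i x - g i z"
    if i: "i < n" and x: "x \<in> {b i..b (Suc i)}" and z: "z \<in> {b i..b (Suc i)}" for i x z and k :: int
  proof -
    have "b 0 \<le> b i" "b (Suc i) \<le> b n" using bmono i by auto
    then have "x \<in> {0..1}" "z \<in> {0..1}" using x z b0 bn by auto
    then have "u (of_int k + x) = f x + p * of_int k" "u (of_int k + z) = f z + p * of_int k"
      using u(3)[of "of_int k + x" k] u(3)[of "of_int k + z" k] by auto
    then show ?thesis using f(4)[OF i x] f(4)[OF i z] by simp
  qed
  have R1: "germ_similar 1 u (of_int k + z) w ((z - b i) / l i)" if i: "i < n" and z: "b i \<le> z" "z < d i"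
    for i z and k :: int
  proof (rule germ_similarI[of "l i" "d i - z"])
    fix h assume "0 < h" "h < d i - z"
    then show "u (of_int k + z + 1 * h) - u (of_int k + z) = l i * (w ((z - b i) / l i + 1 * h / l i) - w ((z - b i) / l i))"
      using incr[OF i, of "z + h" z k] z bd[OF i]
      by (simp add: g_def add.assoc add_divide_distrib[symmetric] algebra_simps)
  qed (use z lr[OF i] in auto)
  have R2: "germ_similar 1 u (of_int k + z) w (s + (z - d i) / r i)" if i: "i < n" and z: "d i \<le> z" "z < b (Suc i)"
    for i z and k :: int
  proof (rule germ_similarI[of "r i" "b (Suc i) - z"])
    fix h assume "0 < h" "h < b (Suc i) - z"
    then show "u (of_int k + z + 1 * h) - u (of_int k + z) = r i * (w (s + (z - d i) / r i + 1 * h / r i) - w (s + (z - d i) / r i))"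
      using incr[OF i, of "z + h" z k] z bd[OF i] gd[OF i, of z] gd[OF i, of "z + h"]
      by (simp add: add.assoc add_divide_distrib[symmetric] algebra_simps)
  qed (use z lr[OF i] in auto)
  have L1: "germ_similar (- 1) u (of_int k + z) w ((z - b i) / l i)" if i: "i < n" and z: "b i < z" "z \<le> d i"
    for i z and k :: int
  proof (rule germ_similarI[of "l i" "z - b i"])
    fix h assume "0 < h" "h < z - b i"
    then show "u (of_int k + z + - 1 * h) - u (of_int k + z) = l i * (w ((z - b i) / l i + - 1 * h / l i) - w ((z - b i) / l i))"
      using incr[OF i, of "z - h" z k] z bd[OF i]
      by (simp add: g_def diff_divide_distrib[symmetric] algebra_simps)
  qed (use z lr[OF i] in auto)
  have L2: "germ_similar (- 1) u (of_int k + z) w (s + (z - d i) / r i)" if i: "i < n" and z: "d i < z" "z \<le> b (Suc i)"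
    for i z and k :: int
  proof (rule germ_similarI[of "r i" "z - d i"])
    fix h assume "0 < h" "h < z - d i"
    then show "u (of_int k + z + - 1 * h) - u (of_int k + z) = r i * (w (s + (z - d i) / r i + - 1 * h / r i) - w (s + (z - d i) / r i))"
      using incr[OF i, of "z - h" z k] z bd[OF i] gd[OF i, of z] gd[OF i, of "z - h"]
      by (simp add: diff_divide_distrib[symmetric] algebra_simps)
  qed (use z lr[OF i] in auto)
  have V1k: "V1 (of_int k + z) = V1 z" for k z
    using periodic1_of_int[of V1 z k] V1 by (simp add: C_torus_def add.commute)
  have Vl: "V1 (of_int k + z) = V2 ((z - b i) / l i)" if i: "i < n" and z: "b i \<le> z" "z \<le> d i" for i z and k :: int
  proof -
    have "(z - b i) / l i \<le> (d i - b i) / l i" using z lr[OF i] by (intro divide_right_mono) auto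
    then have "(z - b i) / l i \<in> {0..s}" using ls[OF i] z lr[OF i] by simp
    then show ?thesis
      using V2l[of "(z - b i) / l i"] V1l[OF i, of z] z s bd[OF i] by (simp add: V1k l_def)
  qed
  have Vr: "V1 (of_int k + z) = V2 (s + (z - d i) / r i)" if i: "i < n" and z: "d i \<le> z" "z \<le> b (Suc i)" for i z and k :: int
  proof -
    have "(z - d i) / r i \<le> (b (Suc i) - d i) / r i" using z lr[OF i] by (intro divide_right_mono) auto
    then have "s + (z - d i) / r i \<in> {s..1}" using ls[OF i] z lr[OF i] by simp
    then have "V2 (s + (z - d i) / r i) = (s + (z - d i) / r i - 1) / (1 - s)" by (rule V2r)
    also have "s + (z - d i) / r i - 1 = (1 - s) * ((z - d i) / (b (Suc i) - d i) - 1)"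
      by (simp add: r_def algebra_simps)
    also have "\<dots> / (1 - s) = (z - d i) / (b (Suc i) - d i) - 1" using s by simp
    also have "\<dots> = - ((b (Suc i) - z) / (b (Suc i) - d i))"
      using bd[OF i] by (simp add: field_simps)
    finally show ?thesis using V1r[OF i, of z] z by (simp add: V1k)
  qed
  \<comment> \<open>At a peak the left germ is modelled at 1 and the right germ at 0. Since
    \<open>w (x + 1) = w x + p\<close>, the left germ can be moved to 0, giving both sides the same
    base point.\<close>
  have wrap: "germ_similar (- 1) u x w 0" if "germ_similar (- 1) u x w 1" for x
  proof -
    have "w (1 + - 1 * h / q) - w 1 = w (0 + - 1 * h / q) - w 0" for h q
      using w1[of "- h / q"] w1[of 0] by (simp add: add.commute)
    then show ?thesis using that unfolding germ_similar_def by simp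
  qed
  have germ: "\<exists>y. V1 x = V2 y \<and> germ_similar 1 u x w y \<and> germ_similar (- 1) u x w y" for x
  proof -
    define k z where "k = \<lfloor>x\<rfloor>" and "z = frac x"
    have x: "x = of_int k + z" and z01: "0 \<le> z" "z < 1"
      by (simp_all add: k_def z_def frac_def frac_lt_1) (use frac_lt_1 frac_def in metis)
    obtain i where i: "i < n" "b i \<le> z" "z < b (Suc i)"
      using partition_cover_left_closed[of b z n] z01 b0 bn by auto
    consider "z = b i" | "b i < z" "z < d i" | "z = d i" | "d i < z" using i by linarith
    then show ?thesis
    proof cases
      case 1
      \<comment> \<open>The piece to the left of a peak belongs to the previous tooth; for
        \<open>i = 0\<close> this is the last tooth of the previous period.\<close>
      have left: "germ_similar (- 1) u x w 1"
      proof (cases i)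
        case 0
        then have "x = of_int (k - 1) + 1" using 1 b0 x by simp
        moreover obtain j where j: "n = Suc j" using i(1) by (cases n) auto
        ultimately show ?thesis
          using L2[of j 1 "k - 1"] bd[of j] bn ls(2)[of j] by simp
      next
        case (Suc j)
        then show ?thesis using L2[of j z k] bd[of j] ls(2)[of j] 1 i x by simp
      qed
      have "germ_similar 1 u x w 0" "V1 x = V2 0"
        using R1[OF i(1), of z k] Vl[OF i(1), of z k] bd[OF i(1)] 1 x by auto
      then show ?thesis using wrap[OF left] by blast
    next
      case 2
      then show ?thesis using R1[OF i(1), of z k] L1[OF i(1), of z k] Vl[OF i(1), of z k] x by auto
    next
      case 3
      then show ?thesis
        using R2[OF i(1), of z k] L1[OF i(1), of z k] Vl[OF i(1), of z k] bd[OF i(1)] ls(1)[OF i(1)] x by auto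
    next
      case 4
      then show ?thesis using R2[OF i(1), of z k] L2[OF i(1), of z k] Vr[OF i(1), of z k] x i by auto
    qed
  qed
  then have germ': "\<exists>y. (\<forall>q. H q + V1 x - c = H q + V2 y - c) \<and> germ_similar 1 u x w y \<and> germ_similar (- 1) u x w y" for x
    by (metis (no_types, lifting))
  define v1 where "v1 x = u x - p * x" for x
  have "v1 \<in> C_torus"
    using u(1,2) by (auto simp: v1_def C_torus_def periodic1_def algebra_simps intro!: continuous_intros)
  moreover have "viscosity_solution (\<lambda>x q. H q + V1 x - c) u"
    using w_sol viscosity_subsolution_rescale[OF _ germ'] viscosity_supersolution_rescale[OF _ germ']
    unfolding viscosity_solution_def by blast
  then have "viscosity_solution (\<lambda>x q. H q + V1 x - c) (\<lambda>x. p * x + v1 x)"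
    by (simp add: v1_def)
  ultimately show ?thesis
    unfolding cell_problem_solution_iff_add_linear by blast
qed

text \<open>Existence supplies a solution for the tent; transferring it in this one direction
  suffices by uniqueness of the constant.\<close>

lemma effective_hamiltonian_sawtooth:
  assumes "0 < s" "s < 1" "tent s V2" "sawtooth n b d V1" "(\<Sum>i<n. d i - b i) = s"
    and "continuous_on UNIV H" "coercive H"
  shows "effective_hamiltonian H V1 p = effective_hamiltonian H V2 p"
proof -
  obtain v2 where "cell_problem_solution H V2 p (effective_hamiltonian H V2 p) v2"
    using effective_hamiltonian_solution[OF assms(6,7), of V2 p] assms(3) by (auto simp: tent_def)
  from cell_problem_solution_sawtooth[OF assms(1-5) this] show ?thesis
    using effective_hamiltonian_eqI assms(4) by (auto simp: sawtooth_def)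
qed

lemma tent_exists:
  assumes "0 < s" "s < 1"
  obtains V where "tent s V"
proof -
  define f where "f x = (if x \<le> s then - (x / s) else (x - 1) / (1 - s))" for x
  have "continuous_on ({0..s} \<union> {s..1}) f"
    unfolding f_def[abs_def]
    by (rule continuous_on_cases) (use assms in \<open>auto intro!: continuous_intros simp: field_simps\<close>)
  moreover have "{0..s} \<union> {s..1} = {0..1}" using assms by auto
  moreover have "f 1 = f 0 + 0" using assms by (simp add: f_def)
  ultimately obtain V where V: "continuous_on UNIV V" "\<And>x. V (x + 1) = V x + 0"
    "\<And>(k::int) x. x \<in> {of_int k..of_int k + 1} \<Longrightarrow> V x = f (x - of_int k) + 0 * of_int k"
    using quasi_periodic_extension[of f 0] by metis
  have "V x = f x" if "x \<in> {0..1}" for x using V(3)[of x 0] that by simp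
  then have "tent s V"
    using assms V(1,2) by (auto simp: tent_def C_torus_def periodic1_def f_def field_simps)
  then show thesis by (rule that)
qed

subsection \<open>Explicit profiles over a tent\<close>

lemma touching_above_one_sided:
  fixes u \<phi> :: "real \<Rightarrow> real"
  assumes l: "(u has_real_derivative l) (at_left x)" and r: "(u has_real_derivative r) (at_right x)"
    and q: "(\<phi> has_real_derivative q) (at x)" and m: "\<forall>\<^sub>F y in nhds x. u y - \<phi> y \<le> u x - \<phi> x"
  shows "r \<le> q" "q \<le> l"
proof -
  define f where "f y = u y - \<phi> y" for y
  have fl: "((\<lambda>y. (f y - f x) / (y - x)) \<longlongrightarrow> l - q) (at_left x)"
    and fr: "((\<lambda>y. (f y - f x) / (y - x)) \<longlongrightarrow> r - q) (at_right x)"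
    using DERIV_diff[OF l has_field_derivative_at_within[OF q]] DERIV_diff[OF r has_field_derivative_at_within[OF q]]
    by (simp_all add: has_field_derivative_iff f_def[abs_def])
  have "\<forall>\<^sub>F y in at x. f y \<le> f x"
    using m by (simp add: f_def eventually_at_filter eventually_mono)
  then have ml: "\<forall>\<^sub>F y in at_left x. f y \<le> f x" and mr: "\<forall>\<^sub>F y in at_right x. f y \<le> f x"
    unfolding eventually_at_split by auto
  have "\<forall>\<^sub>F y in at_right x. (f y - f x) / (y - x) \<le> 0"
    using mr eventually_at_right_less by eventually_elim (simp add: divide_nonpos_pos)
  from tendsto_upperbound[OF fr this] show "r \<le> q" by simp
  have "\<forall>\<^sub>F y in at_left x. y < x" by (simp add: eventually_at_filter)
  with ml have "\<forall>\<^sub>F y in at_left x. (f y - f x) / (y - x) \<ge> 0"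
    by eventually_elim (simp add: divide_nonpos_neg)
  from tendsto_lowerbound[OF fl this] show "q \<le> l" by simp
qed

text \<open>Only concave kinks, with \<open>r \<le> l\<close>, can be touched from above; at a
  convex kink the condition on \<open>q\<close> is vacuous.\<close>

lemma viscosity_subsolution_one_sidedI:
  assumes "\<And>x. \<exists>l r. (u has_real_derivative l) (at_left x) \<and> (u has_real_derivative r) (at_right x) \<and>
    (\<forall>q. r \<le> q \<longrightarrow> q \<le> l \<longrightarrow> G x q \<le> 0)"
  shows "viscosity_subsolution G u"
proof (rule viscosity_subsolutionI)
  fix \<phi> \<phi>' :: "real \<Rightarrow> real" and x0
  assume d: "\<And>x. (\<phi> has_real_derivative \<phi>' x) (at x)"
    and m: "\<forall>\<^sub>F x in nhds x0. u x - \<phi> x \<le> u x0 - \<phi> x0"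
  obtain l r where "(u has_real_derivative l) (at_left x0)" "(u has_real_derivative r) (at_right x0)"
    "\<And>q. r \<le> q \<Longrightarrow> q \<le> l \<Longrightarrow> G x0 q \<le> 0"
    using assms by blast
  then show "G x0 (\<phi>' x0) \<le> 0"
    using touching_above_one_sided[OF _ _ d m] by blast
qed

lemma viscosity_supersolution_one_sidedI:
  assumes "\<And>x. \<exists>l r. (u has_real_derivative l) (at_left x) \<and> (u has_real_derivative r) (at_right x) \<and>
    (\<forall>q. l \<le> q \<longrightarrow> q \<le> r \<longrightarrow> G x q \<ge> 0)"
  shows "viscosity_supersolution G u"
  unfolding viscosity_supersolution_iff_neg
proof (rule viscosity_subsolution_one_sidedI)
  fix x
  obtain l r where "(u has_real_derivative l) (at_left x)" "(u has_real_derivative r) (at_right x)"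
    "\<And>q. l \<le> q \<Longrightarrow> q \<le> r \<Longrightarrow> G x q \<ge> 0"
    using assms by blast
  then show "\<exists>l r. ((\<lambda>x. - u x) has_real_derivative l) (at_left x) \<and>
      ((\<lambda>x. - u x) has_real_derivative r) (at_right x) \<and> (\<forall>q. r \<le> q \<longrightarrow> q \<le> l \<longrightarrow> - G x (- q) \<le> 0)"
    by (intro exI[of _ "- l"] exI[of _ "- r"]) (auto intro: DERIV_minus)
qed

text \<open>\<open>T\<close> and \<open>S\<close> are half-lines in the applications. For negative
  \<open>\<alpha>\<close> they lie on opposite sides, which is how a right derivative of
  \<open>u\<close> comes from a left derivative of \<open>W\<close>.\<close>

lemma one_sided_derivative_affine:
  fixes W :: "real \<Rightarrow> real"
  assumes W: "(W has_real_derivative D) (at (\<alpha> * x + \<beta>) within S)"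
    and S: "\<And>z. z \<in> T \<Longrightarrow> \<alpha> * z + \<beta> \<in> S"
    and eq: "\<forall>\<^sub>F z in at x within T. u z = \<gamma> * W (\<alpha> * z + \<beta>) + \<kappa>" "u x = \<gamma> * W (\<alpha> * x + \<beta>) + \<kappa>"
  shows "(u has_real_derivative \<gamma> * (D * \<alpha>)) (at x within T)"
proof -
  have "((\<lambda>z. \<alpha> * z + \<beta>) has_real_derivative \<alpha>) (at x within T)"
    by (auto intro!: derivative_eq_intros)
  moreover have "(W has_real_derivative D) (at (\<alpha> * x + \<beta>) within (\<lambda>z. \<alpha> * z + \<beta>) ` T)"
    using W S by (intro has_field_derivative_subset[OF W]) auto
  ultimately have "((\<lambda>z. W (\<alpha> * z + \<beta>)) has_real_derivative D * \<alpha>) (at x within T)"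
    using DERIV_image_chain[of W D "\<lambda>z. \<alpha> * z + \<beta>" x T \<alpha>] by (simp add: comp_def)
  then have "((\<lambda>z. \<gamma> * W (\<alpha> * z + \<beta>) + \<kappa>) has_real_derivative \<gamma> * (D * \<alpha>)) (at x within T)"
    by (auto intro!: derivative_eq_intros)
  then show ?thesis
    using has_field_derivative_cong_eventually[OF eq] by simp
qed

lemma continuous_on_one_sided_derivatives:
  fixes f :: "real \<Rightarrow> real"
  assumes "\<And>x. x \<in> S \<Longrightarrow> (f has_real_derivative l x) (at_left x)"
    and "\<And>x. x \<in> S \<Longrightarrow> (f has_real_derivative r x) (at_right x)"
  shows "continuous_on S f"
  using DERIV_continuous[OF assms(1)] DERIV_continuous[OF assms(2)]
  by (simp add: continuous_at_imp_continuous_on continuous_at_split)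

text \<open>\<open>W1\<close> and \<open>W2\<close> are the profiles on the decreasing and the increasing piece, as functions of the
  level \<open>y = c - V x\<close>; \<open>A1, A2\<close> and \<open>B1, B2\<close> are their left and right derivatives. On the increasing
  piece \<open>y\<close> decreases with \<open>x\<close>, so there the roles of left and right are swapped.\<close>

lemma tent_profile:
  assumes s: "0 < s" "s < 1" and tent: "tent s V" and c: "0 < c" "c < 1"
    and W1: "\<And>y. 0 < y \<Longrightarrow> y < 2 \<Longrightarrow> (W1 has_real_derivative A1 y) (at_left y)"
      "\<And>y. 0 < y \<Longrightarrow> y < 2 \<Longrightarrow> (W1 has_real_derivative B1 y) (at_right y)"
    and W2: "\<And>y. 0 < y \<Longrightarrow> y < 2 \<Longrightarrow> (W2 has_real_derivative A2 y) (at_left y)"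
      "\<And>y. 0 < y \<Longrightarrow> y < 2 \<Longrightarrow> (W2 has_real_derivative B2 y) (at_right y)"
    and p: "p = s * (W1 (c + 1) - W1 c) + (1 - s) * (W2 (c + 1) - W2 c)"
  obtains v where "v \<in> C_torus"
    "\<And>x. \<exists>y l r. V x = c - y \<and>
      ((\<lambda>x. p * x + v x) has_real_derivative l) (at_left x) \<and>
      ((\<lambda>x. p * x + v x) has_real_derivative r) (at_right x) \<and>
      (y = c \<and> l = B2 y \<and> r = B1 y \<or> c < y \<and> y < c + 1 \<and> l = A1 y \<and> r = B1 y \<or>
       c < y \<and> y < c + 1 \<and> l = B2 y \<and> r = A2 y \<or> y = c + 1 \<and> l = A1 y \<and> r = A2 y)"
proof -
  \<comment> \<open>The levels \<open>c - V x\<close> fill \<open>{c..c+1}\<close>, which lies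
    inside the interval from 0 to 2.\<close>
  have cW: "continuous_on {c..c+1} W1" "continuous_on {c..c+1} W2"
    using c by (auto intro!: continuous_on_one_sided_derivatives[OF W1] continuous_on_one_sided_derivatives[OF W2])
  \<comment> \<open>The constant for which the two formulas for \<open>f\<close> agree at
    \<open>x = s\<close>.\<close>
  define \<kappa> where "\<kappa> = s * (W1 (c + 1) - W1 c) + (1 - s) * W2 (c + 1)"
  \<comment> \<open>The outer factors \<open>s\<close> and \<open>- (1 - s)\<close> cancel the inner
    slopes \<open>1 / s\<close> and \<open>- 1 / (1 - s)\<close>, so the derivative of
    \<open>f\<close> is that of the profile at the current level.\<close>
  define f where "f x = (if x \<le> s then s * W1 (1 / s * x + c) + - s * W1 c
      else - (1 - s) * W2 (- 1 / (1 - s) * x + (c + 1 / (1 - s))) + \<kappa>)" for x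
  have arg: "- 1 / (1 - s) * x + (c + 1 / (1 - s)) = c + (1 - x) / (1 - s)" for x
    by (simp add: diff_divide_distrib)
  have arg_s: "- 1 / (1 - s) * s + (c + 1 / (1 - s)) = c + 1"
    unfolding arg using s by simp
  have fr: "f x = - (1 - s) * W2 (- 1 / (1 - s) * x + (c + 1 / (1 - s))) + \<kappa>" if "x \<ge> s" for x
  proof (cases "x = s")
    case True
    have "f s = s * W1 (1 + c) + - s * W1 c" using s by (simp add: f_def)
    then show ?thesis unfolding True arg_s \<kappa>_def by (simp add: algebra_simps)
  qed (use that in \<open>simp add: f_def\<close>)
  have "continuous_on ({0..s} \<union> {s..1}) f"
    unfolding f_def[abs_def]
  proof (rule continuous_on_cases)
    show "continuous_on {0..s} (\<lambda>x. s * W1 (1 / s * x + c) + - s * W1 c)"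
      using s by (intro continuous_intros continuous_on_compose2[OF cW(1)]) (auto simp: field_simps)
    show "continuous_on {s..1} (\<lambda>x. - (1 - s) * W2 (- 1 / (1 - s) * x + (c + 1 / (1 - s))) + \<kappa>)"
      unfolding arg using s
      by (intro continuous_intros continuous_on_compose2[OF cW(2)]) (auto simp: field_simps)
    show "\<forall>x. (x \<in> {0..s} \<and> \<not> x \<le> s) \<or> (x \<in> {s..1} \<and> x \<le> s) \<longrightarrow>
        s * W1 (1 / s * x + c) + - s * W1 c = - (1 - s) * W2 (- 1 / (1 - s) * x + (c + 1 / (1 - s))) + \<kappa>"
      using fr[of s] by (auto simp: f_def)
  qed auto
  moreover have "{0..s} \<union> {s..1} = {0..1}" using s by auto
  moreover have "f 1 = f 0 + p"
  proof -
    have "f 0 = 0" using s by (simp add: f_def)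
    moreover have "f 1 = - (1 - s) * W2 c + \<kappa>" using fr[of 1] s by (simp add: arg)
    ultimately show ?thesis by (simp add: p \<kappa>_def algebra_simps)
  qed
  ultimately obtain u where u: "continuous_on UNIV u" "\<And>x. u (x + 1) = u x + p"
    "\<And>(k::int) x. x \<in> {of_int k..of_int k + 1} \<Longrightarrow> u x = f (x - of_int k) + p * of_int k"
    using quasi_periodic_extension[of f p] by metis
  \<comment> \<open>The integer translation is absorbed into the affine coefficients, the form
    required by \<open>one_sided_derivative_affine\<close>.\<close>
  have up: "u x = s * W1 (1 / s * x + (c - of_int k / s)) + (p * of_int k - s * W1 c)"
    if "of_int k \<le> x" "x \<le> of_int k + s" for x and k :: int
  proof -
    have "u x = f (x - of_int k) + p * of_int k" using u(3)[of x k] that s by simp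
    also have "f (x - of_int k) = s * W1 (1 / s * (x - of_int k) + c) + - s * W1 c"
      using that by (simp add: f_def)
    also have "1 / s * (x - of_int k) + c = 1 / s * x + (c - of_int k / s)"
      by (simp add: diff_divide_distrib)
    finally show ?thesis by simp
  qed
  have down: "u x = - (1 - s) * W2 (- 1 / (1 - s) * x + (c + (1 + of_int k) / (1 - s))) + (\<kappa> + p * of_int k)"
    if "of_int k + s \<le> x" "x \<le> of_int k + 1" for x and k :: int
  proof -
    have "u x = f (x - of_int k) + p * of_int k" using u(3)[of x k] that s by simp
    also have "f (x - of_int k) = - (1 - s) * W2 (- 1 / (1 - s) * (x - of_int k) + (c + 1 / (1 - s))) + \<kappa>"
      using that by (intro fr) simp
    also have "- 1 / (1 - s) * (x - of_int k) + (c + 1 / (1 - s)) = - 1 / (1 - s) * x + (c + (1 + of_int k) / (1 - s))"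
      by (simp add: diff_divide_distrib add_divide_distrib algebra_simps)
    finally show ?thesis by simp
  qed
  have up_lev: "1 / s * (of_int k + z) + (c - of_int k / s) = c + z / s" for z and k :: int
    by (simp add: add_divide_distrib)
  have down_lev: "- 1 / (1 - s) * (of_int k + z) + (c + (1 + of_int k) / (1 - s)) = c + (1 - z) / (1 - s)" for z and k :: int
    by (simp add: diff_divide_distrib add_divide_distrib distrib_left)
  have ev_r: "\<forall>\<^sub>F z in at_right x. z \<in> {x<..<e}" if "x < e" for x e :: real
    using that by (rule eventually_at_right_real)
  have ev_l: "\<forall>\<^sub>F z in at_left x. z \<in> {e<..<x}" if "e < x" for x e :: real
    using that by (rule eventually_at_left_real)
  have UR: "(u has_real_derivative B1 (c + z / s)) (at_right (of_int k + z))" if "0 \<le> z" "z < s" for z and k :: int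
  proof -
    have lev: "0 \<le> z / s" "z / s < 1" using that s by auto
    have "(u has_real_derivative s * (B1 (c + z / s) * (1 / s))) (at_right (of_int k + z))"
    proof (rule one_sided_derivative_affine)
      show "(W1 has_real_derivative B1 (c + z / s)) (at (1 / s * (of_int k + z) + (c - of_int k / s)) within {c + z / s<..})"
        unfolding up_lev using W1(2)[of "c + z / s"] lev c by simp
      show "1 / s * y + (c - of_int k / s) \<in> {c + z / s<..}" if "y \<in> {of_int k + z<..}" for y
        unfolding up_lev[of k z, symmetric] using that s by (simp add: divide_strict_right_mono)
      show "\<forall>\<^sub>F y in at_right (of_int k + z). u y = s * W1 (1 / s * y + (c - of_int k / s)) + (p * of_int k - s * W1 c)"
        by (rule eventually_mono[OF ev_r[of "of_int k + z" "of_int k + s"]], use that in simp, rule up) (use that in auto)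
    qed (use that up in auto)
    then show ?thesis using s by simp
  qed
  have UL: "(u has_real_derivative A1 (c + z / s)) (at_left (of_int k + z))" if "0 < z" "z \<le> s" for z and k :: int
  proof -
    have lev: "0 < z / s" "z / s \<le> 1" using that s by auto
    have "(u has_real_derivative s * (A1 (c + z / s) * (1 / s))) (at_left (of_int k + z))"
    proof (rule one_sided_derivative_affine)
      show "(W1 has_real_derivative A1 (c + z / s)) (at (1 / s * (of_int k + z) + (c - of_int k / s)) within {..<c + z / s})"
        unfolding up_lev using W1(1)[of "c + z / s"] lev c by simp
      show "1 / s * y + (c - of_int k / s) \<in> {..<c + z / s}" if "y \<in> {..<of_int k + z}" for y
        unfolding up_lev[of k z, symmetric] using that s by (simp add: divide_strict_right_mono)
      show "\<forall>\<^sub>F y in at_left (of_int k + z). u y = s * W1 (1 / s * y + (c - of_int k / s)) + (p * of_int k - s * W1 c)"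
        by (rule eventually_mono[OF ev_l[of "of_int k" "of_int k + z"]], use that in simp, rule up) (use that in auto)
    qed (use that up in auto)
    then show ?thesis using s by simp
  qed
  have cancel: "- (1 - s) * (X * (- 1 / (1 - s))) = X" for X
    using s by (simp add: field_simps)
  have DR: "(u has_real_derivative A2 (c + (1 - z) / (1 - s))) (at_right (of_int k + z))" if "s \<le> z" "z < 1" for z and k :: int
  proof -
    have lev: "0 < (1 - z) / (1 - s)" "(1 - z) / (1 - s) \<le> 1" using that s by auto
    have "(u has_real_derivative - (1 - s) * (A2 (c + (1 - z) / (1 - s)) * (- 1 / (1 - s)))) (at_right (of_int k + z))"
    proof (rule one_sided_derivative_affine)
      show "(W2 has_real_derivative A2 (c + (1 - z) / (1 - s)))
          (at (- 1 / (1 - s) * (of_int k + z) + (c + (1 + of_int k) / (1 - s))) within {..<c + (1 - z) / (1 - s)})"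
        unfolding down_lev using W2(1)[of "c + (1 - z) / (1 - s)"] lev c by simp
      show "- 1 / (1 - s) * y + (c + (1 + of_int k) / (1 - s)) \<in> {..<c + (1 - z) / (1 - s)}"
        if "y \<in> {of_int k + z<..}" for y
        unfolding down_lev[of k z, symmetric] using that s by (simp add: divide_strict_right_mono)
      show "\<forall>\<^sub>F y in at_right (of_int k + z). u y =
          - (1 - s) * W2 (- 1 / (1 - s) * y + (c + (1 + of_int k) / (1 - s))) + (\<kappa> + p * of_int k)"
        by (rule eventually_mono[OF ev_r[of "of_int k + z" "of_int k + 1"]], use that in simp, rule down) (use that in auto)
    qed (use that down in auto)
    then show ?thesis unfolding cancel .
  qed
  have DL: "(u has_real_derivative B2 (c + (1 - z) / (1 - s))) (at_left (of_int k + z))" if "s < z" "z \<le> 1" for z and k :: int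
  proof -
    have lev: "0 \<le> (1 - z) / (1 - s)" "(1 - z) / (1 - s) < 1" using that s by auto
    have "(u has_real_derivative - (1 - s) * (B2 (c + (1 - z) / (1 - s)) * (- 1 / (1 - s)))) (at_left (of_int k + z))"
    proof (rule one_sided_derivative_affine)
      show "(W2 has_real_derivative B2 (c + (1 - z) / (1 - s)))
          (at (- 1 / (1 - s) * (of_int k + z) + (c + (1 + of_int k) / (1 - s))) within {c + (1 - z) / (1 - s)<..})"
        unfolding down_lev using W2(2)[of "c + (1 - z) / (1 - s)"] lev c by simp
      show "- 1 / (1 - s) * y + (c + (1 + of_int k) / (1 - s)) \<in> {c + (1 - z) / (1 - s)<..}"
        if "y \<in> {..<of_int k + z}" for y
        unfolding down_lev[of k z, symmetric] using that s by (simp add: divide_strict_right_mono)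
      show "\<forall>\<^sub>F y in at_left (of_int k + z). u y =
          - (1 - s) * W2 (- 1 / (1 - s) * y + (c + (1 + of_int k) / (1 - s))) + (\<kappa> + p * of_int k)"
        by (rule eventually_mono[OF ev_l[of "of_int k + s" "of_int k + z"]], use that in simp, rule down) (use that in auto)
    qed (use that down in auto)
    then show ?thesis unfolding cancel .
  qed
  define v where "v x = u x - p * x" for x
  have uv: "(\<lambda>x. p * x + v x) = u" by (simp add: v_def)
  show thesis
  proof (rule that[of v])
    show "v \<in> C_torus"
      using u(1,2) by (auto simp: v_def C_torus_def periodic1_def algebra_simps intro!: continuous_intros)
    fix x :: real
    define k z where "k = \<lfloor>x\<rfloor>" and "z = frac x"
    have x: "x = of_int k + z" and z01: "0 \<le> z" "z < 1"
      by (simp_all add: k_def z_def frac_def frac_lt_1) (use frac_lt_1 frac_def in metis)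
    have "V x = V z"
      using periodic1_frac[of V x] tent by (simp add: tent_def C_torus_def z_def)
    then have V: "z \<le> s \<Longrightarrow> V x = - (z / s)" "s \<le> z \<Longrightarrow> V x = (z - 1) / (1 - s)"
      using tent z01 by (auto simp: tent_def)
    \<comment> \<open>Peak, descending piece, valley, ascending piece, in the order of the four
      disjuncts.\<close>
    consider "z = 0" | "0 < z" "z < s" | "z = s" | "s < z" using z01 by linarith
    then show "\<exists>y l r. V x = c - y \<and>
      ((\<lambda>x. p * x + v x) has_real_derivative l) (at_left x) \<and>
      ((\<lambda>x. p * x + v x) has_real_derivative r) (at_right x) \<and>
      (y = c \<and> l = B2 y \<and> r = B1 y \<or> c < y \<and> y < c + 1 \<and> l = A1 y \<and> r = B1 y \<or>
       c < y \<and> y < c + 1 \<and> l = B2 y \<and> r = A2 y \<or> y = c + 1 \<and> l = A1 y \<and> r = A2 y)"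
      unfolding uv
    proof cases
      case 1
      \<comment> \<open>To the left of an integer lies the ascending piece of the previous period,
        whose position there is \<open>z = 1\<close>.\<close>
      then have "x = of_int (k - 1) + 1" using x by simp
      then show "\<exists>y l r. V x = c - y \<and>
        (u has_real_derivative l) (at_left x) \<and> (u has_real_derivative r) (at_right x) \<and>
        (y = c \<and> l = B2 y \<and> r = B1 y \<or> c < y \<and> y < c + 1 \<and> l = A1 y \<and> r = B1 y \<or>
         c < y \<and> y < c + 1 \<and> l = B2 y \<and> r = A2 y \<or> y = c + 1 \<and> l = A1 y \<and> r = A2 y)"
        using DL[of 1 "k - 1"] UR[of z k] x V(1) s 1
        by (intro exI[of _ c] exI[of _ "B2 c"] exI[of _ "B1 c"]) auto
    next
      case 2
      then have "0 < z / s" "z / s < 1" using s by auto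
      then show "\<exists>y l r. V x = c - y \<and>
        (u has_real_derivative l) (at_left x) \<and> (u has_real_derivative r) (at_right x) \<and>
        (y = c \<and> l = B2 y \<and> r = B1 y \<or> c < y \<and> y < c + 1 \<and> l = A1 y \<and> r = B1 y \<or>
         c < y \<and> y < c + 1 \<and> l = B2 y \<and> r = A2 y \<or> y = c + 1 \<and> l = A1 y \<and> r = A2 y)"
        using UL[of z k] UR[of z k] x V(1) 2
        by (intro exI[of _ "c + z / s"] exI[of _ "A1 (c + z / s)"] exI[of _ "B1 (c + z / s)"]) auto
    next
      case 3
      then show "\<exists>y l r. V x = c - y \<and>
        (u has_real_derivative l) (at_left x) \<and> (u has_real_derivative r) (at_right x) \<and>
        (y = c \<and> l = B2 y \<and> r = B1 y \<or> c < y \<and> y < c + 1 \<and> l = A1 y \<and> r = B1 y \<or>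
         c < y \<and> y < c + 1 \<and> l = B2 y \<and> r = A2 y \<or> y = c + 1 \<and> l = A1 y \<and> r = A2 y)"
        using UL[of z k] DR[of z k] x V(1) s
        by (intro exI[of _ "c + 1"] exI[of _ "A1 (c + 1)"] exI[of _ "A2 (c + 1)"]) auto
    next
      case 4
      then have "0 < (1 - z) / (1 - s)" "(1 - z) / (1 - s) < 1" using s z01 by auto
      moreover have "V x = - ((1 - z) / (1 - s))" using V(2) 4 by (simp add: minus_divide_left)
      ultimately show "\<exists>y l r. V x = c - y \<and>
        (u has_real_derivative l) (at_left x) \<and> (u has_real_derivative r) (at_right x) \<and>
        (y = c \<and> l = B2 y \<and> r = B1 y \<or> c < y \<and> y < c + 1 \<and> l = A1 y \<and> r = B1 y \<or>
         c < y \<and> y < c + 1 \<and> l = B2 y \<and> r = A2 y \<or> y = c + 1 \<and> l = A1 y \<and> r = A2 y)"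
        using DL[of z k] DR[of z k] x 4 z01
        by (intro exI[of _ "c + (1 - z) / (1 - s)"] exI[of _ "B2 (c + (1 - z) / (1 - s))"]
            exI[of _ "A2 (c + (1 - z) / (1 - s))"]) auto
    qed
  qed
qed

subsection \<open>The double-well Hamiltonian\<close>

text \<open>\<open>P\<close> inverts one increasing branch of the Hamiltonian, and its
  antiderivative \<open>Q\<close> gives the profile along that branch.\<close>

lemma inverse_branch:
  fixes f :: "real \<Rightarrow> real"
  assumes f: "continuous_on {a..b} f" "strict_mono_on {a..b} f" and ab: "a \<le> b"
  obtains P Q where "\<And>y. P y \<in> {a..b}" "\<And>y. y \<in> {f a..f b} \<Longrightarrow> f (P y) = y"
    "\<And>y. 0 < y \<Longrightarrow> y < 2 \<Longrightarrow> (Q has_real_derivative P y) (at y)"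
proof -
  have inj: "inj_on f {a..b}" using f(2) by (rule strict_mono_on_imp_inj_on)
  have le: "f a \<le> f b"
    using f(2) ab by (metis atLeastAtMost_iff order_refl strict_mono_on_leD)
  have img: "{f a..f b} \<subseteq> f ` {a..b}"
  proof
    fix y assume "y \<in> {f a..f b}"
    then show "y \<in> f ` {a..b}" using IVT'[of f a y b] f(1) ab by auto
  qed
  define g where "g = the_inv_into {a..b} f"
  have gf: "g (f x) = x" if "x \<in> {a..b}" for x
    unfolding g_def using inj that by (rule the_inv_into_f_f)
  have "continuous_on (f ` {a..b}) g"
    using f(1) gf by (intro continuous_on_inv) auto
  then have cg: "continuous_on {f a..f b} g" using img by (rule continuous_on_subset)
  \<comment> \<open>Clamping the level to the range of \<open>f\<close> makes \<open>P\<close>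
    continuous on the whole line, so \<open>Q\<close> exists also at levels which the branch does
    not reach.\<close>
  define P where "P y = g (max (f a) (min (f b) y))" for y
  have cP: "continuous_on S P" for S
    unfolding P_def using le by (intro continuous_on_compose2[OF cg] continuous_intros) auto
  have "P y \<in> {a..b}" for y
  proof -
    have "max (f a) (min (f b) y) \<in> f ` {a..b}" using le img by auto
    then show ?thesis unfolding P_def using gf by auto
  qed
  moreover have "f (P y) = y" if y: "y \<in> {f a..f b}" for y
  proof -
    obtain x where "x \<in> {a..b}" "y = f x" using img y by blast
    moreover have "max (f a) (min (f b) y) = y" using y by auto
    ultimately show ?thesis unfolding P_def using gf by simp
  qed
  moreover have "((\<lambda>y. integral {0..y} P) has_real_derivative P y) (at y)" if "0 < y" "y < 2" for y
    using integral_has_real_derivative[OF cP, of y 0 2] that by (simp add: at_within_Icc_at)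
  ultimately show thesis by (rule that)
qed

lemma continuous_coercive_abs:
  fixes F :: "real \<Rightarrow> real"
  assumes "continuous_on {0..} F" "filterlim F at_top at_top"
  shows "continuous_on UNIV (\<lambda>q. F \<bar>q\<bar>)" "coercive (\<lambda>q. F \<bar>q\<bar>)"
proof -
  show "continuous_on UNIV (\<lambda>q. F \<bar>q\<bar>)"
    by (intro continuous_on_compose2[OF assms(1)] continuous_intros) auto
  have "filterlim (\<lambda>q::real. \<bar>q\<bar>) at_top at_infinity"
    using filterlim_norm_at_top[where 'a = real] by (simp add: real_norm_def[abs_def])
  from filterlim_compose[OF assms(2) this] show "coercive (\<lambda>q. F \<bar>q\<bar>)"
    by (simp add: coercive_def)
qed

text \<open>At level 1/3 the slope of the exact profile for \<open>VA\<close> lies strictly between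
  the slopes of the supersolutions for \<open>Vs\<close> with \<open>t = 1/2\<close> and
  \<open>t = 1/3\<close>. This persists for \<open>c\<close> slightly below 1/3, and comparison then
  keeps the effective Hamiltonian of \<open>Vs\<close> at or above 1/3.\<close>

lemma tent_distinguished:
  fixes F :: "real \<Rightarrow> real"
  assumes contF: "continuous_on {0..} F" and limF: "filterlim F at_top at_top"
    and \<theta>: "0 < \<theta>2" "\<theta>2 < \<theta>1" and F\<theta>: "F 0 = 0" "F \<theta>2 = 1/2" "F \<theta>1 = 1/3"
    and inc: "strict_mono_on {0..\<theta>2} F" "strict_mono_on {\<theta>1..} F"
    and dec: "strict_antimono_on {\<theta>2..\<theta>1} F"
    and As: "0 < s" "s < A" "A < 1" and tents: "tent A VA" "tent s Vs"
  shows "\<exists>p. effective_hamiltonian (\<lambda>q. F \<bar>q\<bar>) VA p \<noteq> effective_hamiltonian (\<lambda>q. F \<bar>q\<bar>) Vs p"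
proof -
  have mono1: "F x \<le> F y" if "0 \<le> x" "x \<le> y" "y \<le> \<theta>2" for x y
    using inc(1) that by (auto intro: strict_mono_on_leD)
  have mono3: "F x \<le> F y" if "\<theta>1 \<le> x" "x \<le> y" for x y
    using inc(2) that by (auto intro: strict_mono_on_leD)
  have anti: "F y \<le> F x" if "\<theta>2 \<le> x" "x \<le> y" "y \<le> \<theta>1" for x y
    using monotone_onD[OF dec, of x y] that by (cases "x = y") auto
  have "\<forall>\<^sub>F r in at_top. 2 \<le> F r \<and> \<theta>1 \<le> r"
    using limF eventually_ge_at_top[of \<theta>1] unfolding filterlim_at_top
    by (auto intro: eventually_conj)
  \<comment> \<open>Cuts the unbounded branch to a compact interval on which all levels from 1/3 up
    to 2 are still attained.\<close>
  then obtain \<Theta> where \<Theta>: "2 \<le> F \<Theta>" "\<theta>1 \<le> \<Theta>"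
    using eventually_happens'[OF trivial_limit_at_top_linorder] by blast
  have "continuous_on {0..\<theta>2} F" using contF by (rule continuous_on_subset) auto
  then obtain P1 Q1 where P1: "\<And>y. P1 y \<in> {0..\<theta>2}" "\<And>y. y \<in> {0..1/2} \<Longrightarrow> F (P1 y) = y"
    and Q1: "\<And>y. 0 < y \<Longrightarrow> y < 2 \<Longrightarrow> (Q1 has_real_derivative P1 y) (at y)"
    using inverse_branch[OF _ inc(1)] \<theta> F\<theta> by (metis less_imp_le)
  have "continuous_on {\<theta>1..\<Theta>} F" using contF by (rule continuous_on_subset) (use \<theta> in auto)
  moreover have "strict_mono_on {\<theta>1..\<Theta>} F" using inc(2) by (rule monotone_on_subset) auto
  ultimately obtain P3 Q3 where P3: "\<And>y. P3 y \<in> {\<theta>1..\<Theta>}" "\<And>y. y \<in> {1/3..F \<Theta>} \<Longrightarrow> F (P3 y) = y"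
    and Q3: "\<And>y. 0 < y \<Longrightarrow> y < 2 \<Longrightarrow> (Q3 has_real_derivative P3 y) (at y)"
    using inverse_branch[OF _ _ \<Theta>(2)] F\<theta> by metis
  have P13: "P1 y < P3 z" "0 \<le> P1 y" "0 \<le> P3 y" for y z
    using P1(1)[of y] P3(1)[of z] P3(1)[of y] \<theta> by auto
  \<comment> \<open>Between the two increasing branches at level 1/3 lies the hump of
    \<open>F\<close>. The bound is the supersolution test at the convex kink where the slope jumps
    up.\<close>
  have F_lower: "1/3 \<le> F q" if "P1 (1/3) \<le> q" "q \<le> P3 (1/3)" for q
  proof -
    consider "q \<le> \<theta>2" | "\<theta>2 \<le> q" "q \<le> \<theta>1" | "\<theta>1 \<le> q" by linarith
    then show ?thesis
    proof cases
      case 1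
      then show ?thesis using mono1[of "P1 (1/3)" q] P1[of "1/3"] that by simp
    next
      case 2
      then show ?thesis using anti[of q \<theta>1] F\<theta> by simp
    next
      case 3
      then show ?thesis using mono3[of \<theta>1 q] F\<theta> by simp
    qed
  qed
  \<comment> \<open>Between the two branches at level 1/2 lies the well of \<open>F\<close>. The
    bound is the subsolution test at the concave kink where the slope jumps back down.\<close>
  have F_upper: "F q \<le> 1/2" if "P1 (1/2) \<le> q" "q \<le> P3 (1/2)" for q
  proof -
    consider "q \<le> \<theta>2" | "\<theta>2 \<le> q" "q \<le> \<theta>1" | "\<theta>1 \<le> q" by linarith
    then show ?thesis
    proof cases
      case 1
      then show ?thesis using mono1[of q \<theta>2] P1(1)[of "1/2"] F\<theta> that by simp
    next
      case 2
      then show ?thesis using anti[of \<theta>2 q] F\<theta> by simp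
    next
      case 3
      then show ?thesis using mono3[of q "P3 (1/2)"] P3(2)[of "1/2"] \<Theta> that by simp
    qed
  qed
  \<comment> \<open>\<open>W t\<close> follows the lower branch up to level \<open>t\<close> and the
    upper branch beyond it. \<open>L t\<close> and \<open>R t\<close> are its one-sided derivatives,
    which can differ only at the level \<open>t\<close> itself.\<close>
  define W where "W t y = (if y \<le> t then Q1 y else Q1 t + (Q3 y - Q3 t))" for t y
  define L where "L t y = (if y \<le> t then P1 y else P3 y)" for t y
  define R where "R t y = (if y < t then P1 y else P3 y)" for t y
  have WL: "(W t has_real_derivative L t y) (at_left y)" if "0 < y" "y < 2" for t y
  proof (cases "y \<le> t")
    case True
    have "\<forall>\<^sub>F z in at_left y. W t z = Q1 z"
      using True by (auto simp: W_def eventually_at_filter)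
    then show ?thesis
      using has_field_derivative_cong_eventually[of "W t" Q1 y "{..<y}"] True Q1[OF that]
      by (simp add: W_def L_def has_field_derivative_at_within)
  next
    case False
    have "\<forall>\<^sub>F z in at_left y. W t z = Q1 t + (Q3 z - Q3 t)"
      using eventually_at_left_real[of t y] False by (auto elim!: eventually_mono simp: W_def)
    moreover have "((\<lambda>z. Q1 t + (Q3 z - Q3 t)) has_real_derivative P3 y) (at_left y)"
      using has_field_derivative_at_within[OF Q3[OF that]] by (auto intro!: derivative_eq_intros)
    ultimately show ?thesis
      using has_field_derivative_cong_eventually[of "W t" "\<lambda>z. Q1 t + (Q3 z - Q3 t)" y "{..<y}"] False
      by (simp add: W_def L_def)
  qed
  have WR: "(W t has_real_derivative R t y) (at_right y)" if "0 < y" "y < 2" for t y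
  proof (cases "y < t")
    case True
    have "\<forall>\<^sub>F z in at_right y. W t z = Q1 z"
      using eventually_at_right_real[OF True] by (auto elim!: eventually_mono simp: W_def)
    then show ?thesis
      using has_field_derivative_cong_eventually[of "W t" Q1 y "{y<..}"] True Q1[OF that]
      by (simp add: W_def R_def has_field_derivative_at_within)
  next
    case False
    have "\<forall>\<^sub>F z in at_right y. W t z = Q1 t + (Q3 z - Q3 t)"
      using False by (auto simp: W_def eventually_at_filter)
    moreover have "((\<lambda>z. Q1 t + (Q3 z - Q3 t)) has_real_derivative P3 y) (at_right y)"
      using has_field_derivative_at_within[OF Q3[OF that]] by (auto intro!: derivative_eq_intros)
    ultimately show ?thesis
      using has_field_derivative_cong_eventually[of "W t" "\<lambda>z. Q1 t + (Q3 z - Q3 t)" y "{y<..}"] False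
      by (simp add: W_def R_def)
  qed
  have FL: "F (L t y) = y" and FR: "F (R t y) = y" and LR: "y \<noteq> t \<Longrightarrow> L t y = R t y"
    if "0 < y" "y < 2" "1/3 \<le> t" "t \<le> 1/2" for t y
    using P1(2)[of y] P3(2)[of y] that \<Theta>(1) by (auto simp: L_def R_def)
  have nonneg: "0 \<le> L t y" "0 \<le> R t y" for t y
    using P13 by (auto simp: L_def R_def)
  have up_super: "y \<le> F q" if "L (1/3) y \<le> q" "q \<le> R (1/3) y" "0 < y" "y < 2" for y q
  proof (cases "y = 1/3")
    case True
    show ?thesis using F_lower[of q] that unfolding True L_def R_def by simp
  next
    case False
    then have "q = L (1/3) y" using LR[of y "1/3"] that by simp
    then show ?thesis using FL[of y "1/3"] that by simp
  qed
  have up_sub: "F q \<le> y" if "R (1/3) y \<le> q" "q \<le> L (1/3) y" "0 < y" "y < 2" for y q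
  proof (cases "y = 1/3")
    case True
    show ?thesis using P13(1)[of "1/3" "1/3"] that unfolding True L_def R_def by simp
  next
    case False
    then have "q = L (1/3) y" using LR[of y "1/3"] that by simp
    then show ?thesis using FL[of y "1/3"] that by simp
  qed
  \<comment> \<open>On the ascending piece the switch at \<open>t\<close> is a concave kink, which
    cannot be touched from below. Hence every \<open>t\<close> between 1/3 and 1/2 is allowed for
    supersolutions, while the subsolution test is established for \<open>t = 1/2\<close>.\<close>
  have down_super: "y \<le> F q" if "R t y \<le> q" "q \<le> L t y" "0 < y" "y < 2" "1/3 \<le> t" "t \<le> 1/2" for t y q
  proof (cases "y = t")
    case True
    then show ?thesis using P13(1)[of t t] that by (simp add: L_def R_def)
  next
    case False
    then have "q = L t y" using LR[of y t] that by simp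
    then show ?thesis using FL[of y t] that by simp
  qed
  have down_sub: "F q \<le> y" if "L (1/2) y \<le> q" "q \<le> R (1/2) y" "0 < y" "y < 2" for y q
  proof (cases "y = 1/2")
    case True
    show ?thesis using F_upper[of q] that unfolding True L_def R_def by simp
  next
    case False
    then have "q = L (1/2) y" using LR[of y "1/2"] that by simp
    then show ?thesis using FL[of y "1/2"] that by simp
  qed
  \<comment> \<open>The increment over one period of the profile with switch level 1/3 on descent
    and \<open>t\<close> on ascent, as in \<open>tent_profile\<close>.\<close>
  define p where "p \<sigma> t c = \<sigma> * (W (1/3) (c + 1) - W (1/3) c) + (1 - \<sigma>) * (W t (c + 1) - W t c)" for \<sigma> t c
  define H where "H q = F \<bar>q\<bar>" for q
  \<comment> \<open>As \<open>c < 1/3\<close>, both slopes at the peak come from the lower branch;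
    at the valley the level \<open>c + 1\<close> exceeds 1/2 and both come from the upper one. So
    kinks occur only at the two switches.\<close>
  have sol: "\<exists>v. cell_problem_solution H VA (p A (1/2) c) c v" if c: "0 < c" "c < 1/3" for c
  proof -
    obtain v where v: "v \<in> C_torus"
      "\<And>x. \<exists>y l r. VA x = c - y \<and>
      ((\<lambda>x. p A (1/2) c * x + v x) has_real_derivative l) (at_left x) \<and>
      ((\<lambda>x. p A (1/2) c * x + v x) has_real_derivative r) (at_right x) \<and>
      (y = c \<and> l = R (1/2) y \<and> r = R (1/3) y \<or> c < y \<and> y < c + 1 \<and> l = L (1/3) y \<and> r = R (1/3) y \<or>
       c < y \<and> y < c + 1 \<and> l = R (1/2) y \<and> r = L (1/2) y \<or> y = c + 1 \<and> l = L (1/3) y \<and> r = L (1/2) y)"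
      by (rule tent_profile[OF _ As(3) tents(1) _ _ WL[of _ "1/3"] WR[of _ "1/3"] WL[of _ "1/2"] WR[of _ "1/2"]
            p_def[of A "1/2" c]]) (use As c in auto)
    have "viscosity_subsolution (\<lambda>x q. H q + VA x - c) (\<lambda>x. p A (1/2) c * x + v x)"
    proof (rule viscosity_subsolution_one_sidedI)
      fix x
      obtain y l r where ylr: "VA x = c - y" "((\<lambda>x. p A (1/2) c * x + v x) has_real_derivative l) (at_left x)"
        "((\<lambda>x. p A (1/2) c * x + v x) has_real_derivative r) (at_right x)"
        "y = c \<and> l = R (1/2) y \<and> r = R (1/3) y \<or> c < y \<and> y < c + 1 \<and> l = L (1/3) y \<and> r = R (1/3) y \<or>
         c < y \<and> y < c + 1 \<and> l = R (1/2) y \<and> r = L (1/2) y \<or> y = c + 1 \<and> l = L (1/3) y \<and> r = L (1/2) y"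
        using v(2) by blast
      have "F q \<le> y" if q: "r \<le> q" "q \<le> l" for q
        using ylr(4)
      proof (elim disjE)
        assume "y = c \<and> l = R (1/2) y \<and> r = R (1/3) y"
        then have "q = P1 c" using q c by (simp add: R_def)
        then show ?thesis using P1(2)[of c] c \<open>y = c \<and> _\<close> by simp
      next
        assume "y = c + 1 \<and> l = L (1/3) y \<and> r = L (1/2) y"
        then have "q = P3 y" using q c by (simp add: L_def)
        then show ?thesis using P3(2)[of y] c \<open>y = c + 1 \<and> _\<close> \<Theta> by simp
      qed (use up_sub[of y q] down_sub[of y q] q c in auto)
      moreover have "0 \<le> r" using ylr(4) nonneg by auto
      ultimately have "H q + VA x - c \<le> 0" if "r \<le> q" "q \<le> l" for q
        using that ylr(1) by (simp add: H_def)
      then show "\<exists>l r. ((\<lambda>x. p A (1/2) c * x + v x) has_real_derivative l) (at_left x) \<and>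
          ((\<lambda>x. p A (1/2) c * x + v x) has_real_derivative r) (at_right x) \<and>
          (\<forall>q. r \<le> q \<longrightarrow> q \<le> l \<longrightarrow> H q + VA x - c \<le> 0)"
        using ylr(2,3) by blast
    qed
    moreover have "viscosity_supersolution (\<lambda>x q. H q + VA x - c) (\<lambda>x. p A (1/2) c * x + v x)"
    proof (rule viscosity_supersolution_one_sidedI)
      fix x
      obtain y l r where ylr: "VA x = c - y" "((\<lambda>x. p A (1/2) c * x + v x) has_real_derivative l) (at_left x)"
        "((\<lambda>x. p A (1/2) c * x + v x) has_real_derivative r) (at_right x)"
        "y = c \<and> l = R (1/2) y \<and> r = R (1/3) y \<or> c < y \<and> y < c + 1 \<and> l = L (1/3) y \<and> r = R (1/3) y \<or>
         c < y \<and> y < c + 1 \<and> l = R (1/2) y \<and> r = L (1/2) y \<or> y = c + 1 \<and> l = L (1/3) y \<and> r = L (1/2) y"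
        using v(2) by blast
      have "y \<le> F q" if q: "l \<le> q" "q \<le> r" for q
        using ylr(4)
      proof (elim disjE)
        assume "y = c \<and> l = R (1/2) y \<and> r = R (1/3) y"
        then have "q = P1 c" using q c by (simp add: R_def)
        then show ?thesis using P1(2)[of c] c \<open>y = c \<and> _\<close> by simp
      next
        assume "y = c + 1 \<and> l = L (1/3) y \<and> r = L (1/2) y"
        then have "q = P3 y" using q c by (simp add: L_def)
        then show ?thesis using P3(2)[of y] c \<open>y = c + 1 \<and> _\<close> \<Theta> by simp
      qed (use up_super[of y q] down_super[of "1/2" y q] q c in auto)
      moreover have "0 \<le> l" using ylr(4) nonneg by auto
      ultimately have "0 \<le> H q + VA x - c" if "l \<le> q" "q \<le> r" for q
        using that ylr(1) by (simp add: H_def)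
      then show "\<exists>l r. ((\<lambda>x. p A (1/2) c * x + v x) has_real_derivative l) (at_left x) \<and>
          ((\<lambda>x. p A (1/2) c * x + v x) has_real_derivative r) (at_right x) \<and>
          (\<forall>q. l \<le> q \<longrightarrow> q \<le> r \<longrightarrow> 0 \<le> H q + VA x - c)"
        using ylr(2,3) by blast
    qed
    ultimately have "cell_problem_solution H VA (p A (1/2) c) c v"
      using v(1) by (simp add: cell_problem_solution_iff_add_linear viscosity_solution_def)
    then show ?thesis by blast
  qed
  have super: "\<exists>v\<in>C_torus. viscosity_supersolution (\<lambda>x q. H (p s t (1/3) + q) + Vs x - 1/3) v"
    if t: "1/3 \<le> t" "t \<le> 1/2" for t
  proof -
    obtain v where v: "v \<in> C_torus"
      "\<And>x. \<exists>y l r. Vs x = 1/3 - y \<and>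
      ((\<lambda>x. p s t (1/3) * x + v x) has_real_derivative l) (at_left x) \<and>
      ((\<lambda>x. p s t (1/3) * x + v x) has_real_derivative r) (at_right x) \<and>
      (y = 1/3 \<and> l = R t y \<and> r = R (1/3) y \<or> 1/3 < y \<and> y < 1/3 + 1 \<and> l = L (1/3) y \<and> r = R (1/3) y \<or>
       1/3 < y \<and> y < 1/3 + 1 \<and> l = R t y \<and> r = L t y \<or> y = 1/3 + 1 \<and> l = L (1/3) y \<and> r = L t y)"
      by (rule tent_profile[OF As(1) _ tents(2) _ _ WL[of _ "1/3"] WR[of _ "1/3"] WL[of _ t] WR[of _ t]
            p_def[of s t "1/3"]]) (use As in auto)
    have "viscosity_supersolution (\<lambda>x q. H q + Vs x - 1/3) (\<lambda>x. p s t (1/3) * x + v x)"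
    proof (rule viscosity_supersolution_one_sidedI)
      fix x
      obtain y l r where ylr: "Vs x = 1/3 - y" "((\<lambda>x. p s t (1/3) * x + v x) has_real_derivative l) (at_left x)"
        "((\<lambda>x. p s t (1/3) * x + v x) has_real_derivative r) (at_right x)"
        "y = 1/3 \<and> l = R t y \<and> r = R (1/3) y \<or> 1/3 < y \<and> y < 1/3 + 1 \<and> l = L (1/3) y \<and> r = R (1/3) y \<or>
         1/3 < y \<and> y < 1/3 + 1 \<and> l = R t y \<and> r = L t y \<or> y = 1/3 + 1 \<and> l = L (1/3) y \<and> r = L t y"
        using v(2) by blast
      have "y \<le> F q" if q: "l \<le> q" "q \<le> r" for q
        using ylr(4)
      proof (elim disjE)
        \<comment> \<open>Here the peak itself is at level 1/3: the slope on the right is already on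
          the upper branch, the one on the left may be on either, and the hump estimate covers the
          jump.\<close>
        assume *: "y = 1/3 \<and> l = R t y \<and> r = R (1/3) y"
        then have y: "y = 1/3" and lr: "l = R t (1/3)" "r = R (1/3) (1/3)" by metis+
        have "P1 (1/3) \<le> l" "r = P3 (1/3)" using P13(1)[of "1/3" "1/3"] unfolding lr by (simp_all add: R_def)
        then show ?thesis unfolding y using F_lower[of q] q by simp
      next
        assume *: "y = 1/3 + 1 \<and> l = L (1/3) y \<and> r = L t y"
        then have "q = P3 y" using q t by (simp add: L_def)
        then show ?thesis using P3(2)[of y] * \<Theta> by simp
      qed (use up_super[of y q] down_super[of t y q] q t in auto)
      moreover have "0 \<le> l" using ylr(4) nonneg by auto
      ultimately have "0 \<le> H q + Vs x - 1/3" if "l \<le> q" "q \<le> r" for q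
        using that ylr(1) by (simp add: H_def)
      then show "\<exists>l r. ((\<lambda>x. p s t (1/3) * x + v x) has_real_derivative l) (at_left x) \<and>
          ((\<lambda>x. p s t (1/3) * x + v x) has_real_derivative r) (at_right x) \<and>
          (\<forall>q. l \<le> q \<longrightarrow> q \<le> r \<longrightarrow> 0 \<le> H q + Vs x - 1/3)"
        using ylr(2,3) by blast
    qed
    then show ?thesis
      using v(1) viscosity_supersolution_add_linear[of "\<lambda>x q. H q + Vs x - 1/3" "p s t (1/3)" v] by auto
  qed
  \<comment> \<open>When both switch levels lie between \<open>c\<close> and \<open>c + 1\<close>,
    the slope splits into \<open>E c\<close>, which depends on the level alone, and a weighted mean
    of \<open>D\<close> at the two switch levels.\<close>
  define D where "D y = Q3 y - Q1 y" for y
  define E where "E c = Q3 (c + 1) - Q1 c" for c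
  have p_eq: "p \<sigma> t c = E c - \<sigma> * D (1/3) - (1 - \<sigma>) * D t" if "0 < c" "c \<le> 1/3" "1/3 \<le> t" "t \<le> 1/2" for \<sigma> t c
    using that by (simp add: p_def W_def D_def E_def algebra_simps)
  \<comment> \<open>\<open>D\<close> has derivative \<open>P3 y - P1 y\<close>, and the upper branch
    lies strictly above the lower one.\<close>
  have D_less: "D (1/3) < D (1/2)"
  proof (rule DERIV_pos_imp_increasing[of "1/3" "1/2" D])
    fix y :: real assume "1/3 \<le> y" "y \<le> 1/2"
    then have "(D has_real_derivative P3 y - P1 y) (at y)"
      unfolding D_def[abs_def] by (intro DERIV_diff Q1 Q3) auto
    then show "\<exists>z. (D has_real_derivative z) (at y) \<and> 0 < z" using P13(1)[of y y] by auto
  qed simp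
  have "isCont Q3 (1/3 + 1)" "isCont Q1 (1/3)"
    using DERIV_isCont Q1[of "1/3"] Q3[of "1/3 + 1"] by auto
  then have "isCont E (1/3)"
    unfolding E_def[abs_def] by (intro continuous_intros isCont_o2[where f = "\<lambda>c. c + 1"]) auto
  then have E_lim: "(E \<longlongrightarrow> E (1/3)) (at_left (1/3))"
    unfolding isCont_def by (rule tendsto_within_subset) simp
  \<comment> \<open>\<open>gap\<close> and \<open>gap'\<close> are the distances at level 1/3 from
    the slope for \<open>VA\<close> to the slopes for \<open>Vs\<close> with \<open>t = 1/2\<close>
    and \<open>t = 1/3\<close>. Positivity of \<open>gap\<close> uses \<open>s < A\<close>, that of
    \<open>gap'\<close> uses \<open>A < 1\<close>.\<close>
  define gap where "gap = (A - s) * (D (1/2) - D (1/3))"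
  have gap: "gap > 0" using As D_less by (simp add: gap_def)
  define gap' where "gap' = (1 - A) * (D (1/2) - D (1/3))"
  have gap': "gap' > 0" using As D_less by (simp add: gap'_def)
  have "\<forall>\<^sub>F c in at_left (1/3). E (1/3) - gap < E c"
    using E_lim gap by (intro order_tendstoD(1)) auto
  moreover have "\<forall>\<^sub>F c in at_left (1/3). E c < E (1/3) + gap'"
    using E_lim gap' by (intro order_tendstoD(2)) auto
  moreover have "\<forall>\<^sub>F c in at_left (1/3). c \<in> {0<..<1/3::real}"
    by (rule eventually_at_left_real) simp
  ultimately have "\<forall>\<^sub>F c in at_left (1/3). E (1/3) - gap < E c \<and> E c < E (1/3) + gap' \<and> c \<in> {0<..<1/3}"
    by eventually_elim simp
  then obtain c where c: "E (1/3) - gap < E c" "E c < E (1/3) + gap'" "0 < c" "c < 1/3"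
    using eventually_happens'[of "at_left (1/3::real)"] by (auto simp: trivial_limit_at_left_real)
  \<comment> \<open>The intermediate value theorem in the switch level \<open>t\<close> matches the
    slope of the supersolution for \<open>Vs\<close> to that of the solution for
    \<open>VA\<close>.\<close>
  have "\<exists>t\<ge>1/3. t \<le> 1/2 \<and> E (1/3) - s * D (1/3) - (1 - s) * D t = p A (1/2) c"
  proof (rule IVT2')
    have "p A (1/2) c = E c - A * D (1/3) - (1 - A) * D (1/2)" using c by (simp add: p_eq)
    then show "E (1/3) - s * D (1/3) - (1 - s) * D (1/2) \<le> p A (1/2) c"
      "p A (1/2) c \<le> E (1/3) - s * D (1/3) - (1 - s) * D (1/3)"
      using c(1,2) by (simp_all add: gap_def gap'_def algebra_simps)
    have "isCont D t" if "t \<in> {1/3..1/2}" for t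
      using DERIV_isCont[OF DERIV_diff[OF Q3 Q1]] that unfolding D_def[abs_def] by simp
    then have "continuous_on {1/3..1/2} D" by (simp add: continuous_at_imp_continuous_on)
    then show "continuous_on {1/3..1/2} (\<lambda>t. E (1/3) - s * D (1/3) - (1 - s) * D t)"
      by (intro continuous_intros)
  qed simp
  then obtain t where t: "1/3 \<le> t" "t \<le> 1/2" "E (1/3) - s * D (1/3) - (1 - s) * D t = p A (1/2) c"
    by blast
  obtain v where v: "v \<in> C_torus" "viscosity_supersolution (\<lambda>x q. H (p A (1/2) c + q) + Vs x - 1/3) v"
    using super[OF t(1,2)] p_eq[of "1/3" t s] t by auto
  have H: "continuous_on UNIV H" "coercive H"
    unfolding H_def[abs_def] by (rule continuous_coercive_abs[OF contF limF])+
  have Vs: "Vs \<in> C_torus" "VA \<in> C_torus" using tents by (auto simp: tent_def)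
  have "effective_hamiltonian H VA (p A (1/2) c) = c"
    using sol[OF c(3,4)] effective_hamiltonian_eqI[OF _ Vs(2)] by blast
  \<comment> \<open>A solution for \<open>Vs\<close> at level \<open>c\<close> would be a
    subsolution with the same slope as the supersolution at level 1/3, forcing
    \<open>1/3 \<le> c\<close>.\<close>
  moreover have "effective_hamiltonian H Vs (p A (1/2) c) \<noteq> c"
  proof
    assume "effective_hamiltonian H Vs (p A (1/2) c) = c"
    then obtain u where "cell_problem_solution H Vs (p A (1/2) c) c u"
      using effective_hamiltonian_solution[OF H Vs(1)] by metis
    then have "1/3 \<le> c"
      using cell_comparison[OF _ v(1) Vs(1) _ v(2), of u c]
      by (simp add: cell_problem_solution_def viscosity_solution_def)
    then show False using c(4) by simp
  qed
  ultimately show ?thesis unfolding H_def[abs_def] by metis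
qed

section \<open>Reduction of the theorem to tents\<close>

lemma linear_on_interval_eq:
  assumes "linear_on_interval l r f" "l < r" "x \<in> {l..r}"
  shows "f x = f l + (f r - f l) * ((x - l) / (r - l))"
proof -
  obtain \<alpha> \<beta> where eq: "\<And>x. x \<in> {l..r} \<Longrightarrow> f x = \<alpha> * x + \<beta>"
    using assms(1) unfolding linear_on_interval_def by blast
  have "(f r - f l) * ((x - l) / (r - l)) = \<alpha> * (x - l)"
    using eq[of l] eq[of r] assms(2) by (simp add: right_diff_distrib[symmetric])
  then show ?thesis using eq[of l] eq[OF assms(3)] assms(2) by (simp add: algebra_simps)
qed

theorem theorem1p4:
  fixes s :: real and m :: nat and a c :: "nat \<Rightarrow> real" and V1 V2 :: "real \<Rightarrow> real"
  assumes "0 < s" and "s < 1"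
    and "periodic1 V2"
    and "\<forall>x\<in>{0..s}. V2 x = - (x / s)"
    and "\<forall>x\<in>{s..1}. V2 x = (x - 1) / (1 - s)"
    and "m \<ge> 2"
    and "a 1 = 0" and "a m = 1"
    and "\<forall>i\<in>{1..m-1}. a i < c i \<and> c i < a (i + 1)"
    and "V1 \<in> C_torus"
    and "\<forall>i\<in>{1..m}. V1 (a i) = 0"
    and "\<forall>i\<in>{1..m-1}. V1 (c i) = -1"
    and "\<forall>i\<in>{1..m-1}. linear_on_interval (a i) (c i) V1 \<and> linear_on_interval (c i) (a (i + 1)) V1"
  shows
    "((\<Sum>i=1..m-1. (c i - a i) / s) = (\<Sum>i=1..m-1. (a (i + 1) - c i) / (1 - s))
        \<longrightarrow> macroscopically_indistinguishable V1 V2) \<and>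
     (\<forall>F :: real \<Rightarrow> real.
        continuous_on {0..} F \<and>
        (\<exists>\<theta>1 \<theta>2 \<theta>3. 0 < \<theta>3 \<and> \<theta>3 < \<theta>2 \<and> \<theta>2 < \<theta>1 \<and>
           F 0 = 0 \<and> F \<theta>2 = 1/2 \<and> F \<theta>1 = 1/3 \<and> F \<theta>3 = 1/3 \<and>
           filterlim F at_top at_top \<and>
           strict_mono_on {0..\<theta>2} F \<and> strict_mono_on {\<theta>1..} F \<and>
           strict_antimono_on {\<theta>2..\<theta>1} F) \<longrightarrow>
        (\<forall>p. effective_hamiltonian (\<lambda>q. F \<bar>q\<bar>) V1 p = effective_hamiltonian (\<lambda>q. F \<bar>q\<bar>) V2 p) \<longrightarrow>
        (\<Sum>i=1..m-1. (c i - a i) / s) = (\<Sum>i=1..m-1. (a (i + 1) - c i) / (1 - s)))"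
proof -
  define n where "n = m - 1"
  \<comment> \<open>Indices are moved to start at 0: \<open>n = m - 1\<close> teeth, the last peak
    being \<open>b n = a m\<close>.\<close>
  define b d where "b i = a (i + 1)" and "d i = c (i + 1)" for i
  have reindex: "(\<Sum>i=1..m-1. f i) = (\<Sum>i<n. f (i + 1))" for f :: "nat \<Rightarrow> real"
    unfolding n_def by (rule sum.reindex_bij_witness[of _ Suc "\<lambda>i. i - 1"]) auto
  have n: "n > 0" "b 0 = 0" "b n = 1"
    using assms(6,7,8) by (auto simp: n_def b_def)
  have bd: "b i < d i" "d i < b (Suc i)" if "i < n" for i
    using assms(9)[rule_format, of "i + 1"] that by (auto simp: n_def b_def d_def)
  have vals: "V1 (b i) = 0" "V1 (d i) = - 1" "V1 (b (Suc i)) = 0" if "i < n" for i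
    using assms(11)[rule_format, of "i + 1"] assms(11)[rule_format, of "i + 2"]
      assms(12)[rule_format, of "i + 1"] that by (auto simp: n_def b_def d_def)
  have lin: "linear_on_interval (b i) (d i) V1" "linear_on_interval (d i) (b (Suc i)) V1" if "i < n" for i
    using assms(13)[rule_format, of "i + 1"] that by (auto simp: n_def b_def d_def)
  have saw: "sawtooth n b d V1"
    unfolding sawtooth_def
  proof (intro conjI allI impI ballI)
    fix i x assume i: "i < n"
    show "b i < d i" "d i < b (Suc i)" using bd[OF i] by auto
    show "V1 x = - ((x - b i) / (d i - b i))" if "x \<in> {b i..d i}"
      using linear_on_interval_eq[OF lin(1)[OF i] bd(1)[OF i] that] vals[OF i]
      by (simp add: minus_divide_left)
    show "V1 x = - ((b (Suc i) - x) / (b (Suc i) - d i))" if "x \<in> {d i..b (Suc i)}"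
      using linear_on_interval_eq[OF lin(2)[OF i] bd(2)[OF i] that] vals[OF i] bd[OF i]
      by (simp add: field_simps)
  qed (use assms(10) n in auto)
  have tent: "tent s V2"
  proof -
    \<comment> \<open>Two periodic functions that agree on one period are equal, so
      \<open>V2\<close> inherits continuity from the constructed tent.\<close>
    obtain V where V: "tent s V" using tent_exists[OF assms(1,2)] .
    have "V2 x = V x" for x
    proof -
      have "frac x \<in> {0..1}" using frac_ge_0[of x] frac_lt_1[of x] by simp
      then have "V2 (frac x) = V (frac x)"
        using assms(4,5) V by (cases "frac x \<le> s") (auto simp: tent_def)
      then show ?thesis
        using periodic1_frac[OF assms(3), of x] periodic1_frac[of V x] V by (simp add: tent_def C_torus_def)
    qed
    then have "V2 = V" by auto
    then show ?thesis using V by simp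
  qed
  define A where "A = (\<Sum>i<n. d i - b i)"
  have "(\<Sum>i<n. b (Suc i) - d i) = (\<Sum>i<n. b (Suc i) - b i) - A"
    by (simp add: A_def sum_subtractf[symmetric])
  then have rest: "(\<Sum>i<n. b (Suc i) - d i) = 1 - A"
    using n by (simp add: sum_lessThan_telescope)
  have A: "0 < A" "A < 1"
  proof -
    show "0 < A" unfolding A_def using n(1) bd by (intro sum_pos) auto
    have "0 < (\<Sum>i<n. b (Suc i) - d i)" using n(1) bd by (intro sum_pos) auto
    then show "A < 1" using rest by simp
  qed
  have left: "(\<Sum>i=1..m-1. (c i - a i) / s) = A / s"
    unfolding reindex by (simp add: A_def b_def d_def sum_divide_distrib)
  have right: "(\<Sum>i=1..m-1. (a (i + 1) - c i) / (1 - s)) = (1 - A) / (1 - s)"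
    unfolding reindex rest[symmetric] by (simp add: b_def d_def sum_divide_distrib)
  \<comment> \<open>The descending pieces have total length \<open>A\<close> and the ascending ones
    \<open>1 - A\<close>, and \<open>A / s = (1 - A) / (1 - s)\<close> holds exactly for
    \<open>A = s\<close>.\<close>
  have star: "(\<Sum>i=1..m-1. (c i - a i) / s) = (\<Sum>i=1..m-1. (a (i + 1) - c i) / (1 - s)) \<longleftrightarrow> A = s"
    unfolding left right using assms(1,2) by (auto simp: field_simps)
  have torus: "V1 \<in> C_torus" "V2 \<in> C_torus" using saw tent by (auto simp: sawtooth_def tent_def)
  show ?thesis
    unfolding star
  proof (intro conjI impI allI)
    assume "A = s"
    then show "macroscopically_indistinguishable V1 V2"
      unfolding macroscopically_indistinguishable_def
      using torus effective_hamiltonian_sawtooth[OF assms(1,2) tent saw] by (auto simp: A_def)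
  next
    fix F :: "real \<Rightarrow> real"
    let ?H = "\<lambda>q. F \<bar>q\<bar>"
    assume F: "continuous_on {0..} F \<and> (\<exists>\<theta>1 \<theta>2 \<theta>3. 0 < \<theta>3 \<and> \<theta>3 < \<theta>2 \<and> \<theta>2 < \<theta>1 \<and>
        F 0 = 0 \<and> F \<theta>2 = 1/2 \<and> F \<theta>1 = 1/3 \<and> F \<theta>3 = 1/3 \<and> filterlim F at_top at_top \<and>
        strict_mono_on {0..\<theta>2} F \<and> strict_mono_on {\<theta>1..} F \<and> strict_antimono_on {\<theta>2..\<theta>1} F)"
      and same: "\<forall>p. effective_hamiltonian ?H V1 p = effective_hamiltonian ?H V2 p"
    from F obtain \<theta>1 \<theta>2 where cF: "continuous_on {0..} F" "filterlim F at_top at_top"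
      and \<theta>: "0 < \<theta>2" "\<theta>2 < \<theta>1" "F 0 = 0" "F \<theta>2 = 1/2" "F \<theta>1 = 1/3"
        "strict_mono_on {0..\<theta>2} F" "strict_mono_on {\<theta>1..} F" "strict_antimono_on {\<theta>2..\<theta>1} F"
      by (meson less_trans)
    obtain VA where VA: "tent A VA" using tent_exists[OF A] .
    \<comment> \<open>The sawtooth \<open>V1\<close> can be replaced by the tent with valley at
      \<open>A\<close>, so two tents remain to be compared.\<close>
    have "effective_hamiltonian ?H VA p = effective_hamiltonian ?H V2 p" for p
      using effective_hamiltonian_sawtooth[OF A VA saw A_def[symmetric] continuous_coercive_abs[OF cF]] same
      by simp
    \<comment> \<open>Each strict order of \<open>A\<close> and \<open>s\<close> is excluded by
      \<open>tent_distinguished\<close>, with the roles of the two tents exchanged.\<close>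
    then show "A = s"
      using tent_distinguished[OF cF \<theta> assms(1) _ A(2) VA tent]
        tent_distinguished[OF cF \<theta> A(1) _ assms(2) tent VA]
      by (cases A s rule: linorder_cases) auto
  qed
qed

end
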